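(* Let $k$ be an algebraically closed field of characteristic two. Every cubic form in $k[x_1,x_2,x_3,x_4]$ can be written uniquely as $$x_1^2L_1+ x_2^2L_2 + x_3^2L_3 + x_4^2L_4 + b_1x_2x_3x_4 + b_2x_1x_3x_4 + b_3 x_1x_2x_4 + b_4x_1x_2x_3,$$ where $L_1,\dots,L_4$ are linear forms over $k$, $L_i=\sum_{j=1}^4 a_{ij}x_j$, and $b_1,\dots,b_4\in k$. Regard the twenty scalars $a_{ij}$ and $b_1,\dots,b_4$ as homogeneous coordinates on the projective space $\mathbb P^{19}$ parametrizing all cubic surfaces in $\mathbb P^3$. Then the set of Frobenius split cubic surfaces is the non-empty Zariski open subset of $\mathbb P^{19}$ complementary to the codimension four linear subspace defined by $b_1=b_2=b_3=b_4=0$. Put differently, a cubic surface is Frobenius split if and only if some $b_i$ is non-zero, that is, if and only if its equation has a square-free monomial with non-zero coefficient.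
   Context: A cubic surface is the subscheme of $\mathbb P^3$ cut out by a single non-zero homogeneous polynomial of degree 3; it may be singular, reducible or non-reduced. A scheme $X$ over a field of characteristic $p>0$ is Frobenius split if the map of sheaves $\mathcal O_X\to F_*\mathcal O_X$ induced by the Frobenius morphism $F:X\to X$ (the identity on the underlying space, the $p$-th power map on functions) splits as a map of $\mathcal O_X$-modules. A ring $R$ of characteristic $p$ is $F$-pure if its Frobenius map $R\to R$, $r\mapsto r^p$, is pure (it stays injective after tensoring with any $R$-module). A cubic surface defined by $f$ is Frobenius split if and only if its homogeneous coordinate ring $k[x_1,x_2,x_3,x_4]/\langle f\rangle$ is $F$-pure. *)

theory Defs
  imports
    "HOL-Analysis.Analysis"
    "HOL-Library.Poly_Mapping"
    "HOL-Library.FuncSet"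
    "HOL-Computational_Algebra.Polynomial"
    "HOL-Algebra.Ring"
begin

section \<open>Polynomials in finitely many variables\<close>

text \<open>The polynomial ring over \<open>'k\<close> in variables indexed by \<open>'n\<close>, as the monoid algebra of the
  exponent vectors.\<close>

type_synonym ('n, 'k) mpoly = "('n \<Rightarrow>\<^sub>0 nat) \<Rightarrow>\<^sub>0 'k"

definition X :: "'n \<Rightarrow> ('n, 'k::field) mpoly"
  where "X i = Poly_Mapping.single (Poly_Mapping.single i 1) 1"

definition Const :: "'k \<Rightarrow> ('n, 'k::field) mpoly"
  where "Const c = Poly_Mapping.single 0 c"

definition eval_mpoly :: "'k ^ 'n \<Rightarrow> ('n::finite, 'k::field) mpoly \<Rightarrow> 'k"
  where "eval_mpoly v g =
    (\<Sum>m \<in> Poly_Mapping.keys g.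
      Poly_Mapping.lookup g m * (\<Prod>i\<in>UNIV. (v $ i) ^ Poly_Mapping.lookup m i))"

definition monom_degree :: "('n::finite \<Rightarrow>\<^sub>0 nat) \<Rightarrow> nat"
  where "monom_degree m = (\<Sum>i\<in>UNIV. Poly_Mapping.lookup m i)"

definition homogeneous :: "nat \<Rightarrow> ('n::finite, 'k::field) mpoly \<Rightarrow> bool"
  where "homogeneous d g \<longleftrightarrow> (\<forall>m \<in> Poly_Mapping.keys g. monom_degree m = d)"

definition homogeneous_component ::
    "nat \<Rightarrow> ('n::finite, 'k::field) mpoly \<Rightarrow> ('n, 'k) mpoly"
  where "homogeneous_component d g =
    (\<Sum>m \<in> {m \<in> Poly_Mapping.keys g. monom_degree m = d}.
      Poly_Mapping.single m (Poly_Mapping.lookup g m))"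

definition homogeneous_prime :: "('n::finite, 'k::field) mpoly set \<Rightarrow> bool"
  where "homogeneous_prime P \<longleftrightarrow>
    0 \<in> P \<and> (\<forall>g\<in>P. \<forall>h\<in>P. g + h \<in> P) \<and> (\<forall>g\<in>P. \<forall>r. r * g \<in> P) \<and>
    1 \<notin> P \<and> (\<forall>g h. g * h \<in> P \<longrightarrow> g \<in> P \<or> h \<in> P) \<and>
    (\<forall>g\<in>P. \<forall>d. homogeneous_component d g \<in> P)"


section \<open>The closed subscheme of projective space cut out by a form\<close>

text \<open>Let \<open>S\<close> be the polynomial ring and \<open>f\<close> a form. The scheme cut out by \<open>f\<close> is \<open>Proj (S/f)\<close>.
  A point of it is a homogeneous prime of \<open>S/f\<close> not containing the irrelevant ideal; it is
  represented by its preimage in \<open>S\<close>. Likewise, elements of \<open>S/f\<close> are represented by polynomials,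
  equality in \<open>S/f\<close> being congruence modulo \<open>f\<close>.\<close>

definition points :: "('n::finite, 'k::field) mpoly \<Rightarrow> ('n, 'k) mpoly set set"
  where "points f = {P. homogeneous_prime P \<and> f \<in> P \<and> \<not> range X \<subseteq> P}"

definition open_subset ::
    "('n::finite, 'k::field) mpoly \<Rightarrow> ('n, 'k) mpoly set set \<Rightarrow> bool"
  where "open_subset f U \<longleftrightarrow>
    (\<exists>T. (\<forall>g\<in>T. \<exists>d. homogeneous d g) \<and> U = {P \<in> points f. \<not> T \<subseteq> P})"

text \<open>The stalk at \<open>P\<close> is the degree zero part of the localization of \<open>S/f\<close> at the homogeneous
  elements outside \<open>P\<close>. As \<open>S/f\<close> may have zero divisors, \<open>a/s = b/t\<close> means that \<open>u (a t - b s)\<close>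
  vanishes in \<open>S/f\<close> for some homogeneous \<open>u\<close> outside \<open>P\<close>.\<close>

definition fractions ::
    "('n::finite, 'k::field) mpoly set \<Rightarrow> (('n, 'k) mpoly \<times> ('n, 'k) mpoly) set"
  where "fractions P = {(a, s). s \<notin> P \<and> (\<exists>d. homogeneous d a \<and> homogeneous d s)}"

definition frac_rel ::
    "('n::finite, 'k::field) mpoly \<Rightarrow> ('n, 'k) mpoly set \<Rightarrow>
      ((('n, 'k) mpoly \<times> ('n, 'k) mpoly) \<times> (('n, 'k) mpoly \<times> ('n, 'k) mpoly)) set"
  where "frac_rel f P = {((a, s), (b, t)). (a, s) \<in> fractions P \<and> (b, t) \<in> fractions P \<and>
    (\<exists>u d. homogeneous d u \<and> u \<notin> P \<and> f dvd u * (a * t - b * s))}"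

type_synonym ('n, 'k) germ = "(('n, 'k) mpoly \<times> ('n, 'k) mpoly) set"

definition stalk ::
    "('n::finite, 'k::field) mpoly \<Rightarrow> ('n, 'k) mpoly set \<Rightarrow> ('n, 'k) germ set"
  where "stalk f P = fractions P // frac_rel f P"

definition frac ::
    "('n::finite, 'k::field) mpoly \<Rightarrow> ('n, 'k) mpoly set \<Rightarrow>
      ('n, 'k) mpoly \<Rightarrow> ('n, 'k) mpoly \<Rightarrow> ('n, 'k) germ"
  where "frac f P a s = frac_rel f P `` {(a, s)}"

definition stalk_add ::
    "('n::finite, 'k::field) mpoly \<Rightarrow> ('n, 'k) mpoly set \<Rightarrow>
      ('n, 'k) germ \<Rightarrow> ('n, 'k) germ \<Rightarrow> ('n, 'k) germ"
  where "stalk_add f P x y = (\<Union>(a, s)\<in>x. \<Union>(b, t)\<in>y. frac f P (a * t + b * s) (s * t))"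

definition stalk_mult ::
    "('n::finite, 'k::field) mpoly \<Rightarrow> ('n, 'k) mpoly set \<Rightarrow>
      ('n, 'k) germ \<Rightarrow> ('n, 'k) germ \<Rightarrow> ('n, 'k) germ"
  where "stalk_mult f P x y = (\<Union>(a, s)\<in>x. \<Union>(b, t)\<in>y. frac f P (a * b) (s * t))"

text \<open>The ring of sections over \<open>U\<close> of the structure sheaf: families of germs that are locally
  given by one fraction.\<close>

definition sections ::
    "('n::finite, 'k::field) mpoly \<Rightarrow> ('n, 'k) mpoly set set \<Rightarrow>
      (('n, 'k) mpoly set \<Rightarrow> ('n, 'k) germ) ring"
  where "sections f U =
    \<lparr> carrier = {\<sigma> \<in> (\<Pi>\<^sub>E P\<in>U. stalk f P).
        \<forall>P\<in>U. \<exists>V a s d. open_subset f V \<and> P \<in> V \<and> V \<subseteq> U \<and>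
          homogeneous d a \<and> homogeneous d s \<and>
          (\<forall>Q\<in>V. s \<notin> Q \<and> \<sigma> Q = frac f Q a s)},
      mult = (\<lambda>\<sigma> \<tau>. \<lambda>P\<in>U. stalk_mult f P (\<sigma> P) (\<tau> P)),
      one = (\<lambda>P\<in>U. frac f P 1 1),
      zero = (\<lambda>P\<in>U. frac f P 0 1),
      add = (\<lambda>\<sigma> \<tau>. \<lambda>P\<in>U. stalk_add f P (\<sigma> P) (\<tau> P)) \<rparr>"

text \<open>With \<open>O\<close> the structure sheaf and \<open>F\<close> the Frobenius morphism, \<open>F\<^sub>*O\<close> is the sheaf of abelian
  groups \<open>O\<close> on which a section \<open>\<sigma>\<close> acts as multiplication by \<open>\<sigma>\<^sup>p\<close>. A splitting is thus a map of
  sheaves \<open>\<phi>\<close> from \<open>O\<close> to \<open>O\<close> that is \<open>O\<close>-linear for this module structure on the source, and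
  satisfies \<open>\<phi> (\<sigma>\<^sup>p) = \<sigma>\<close>.\<close>

definition frobenius_split :: "('n::finite, 'k::field) mpoly \<Rightarrow> bool"
  where "frobenius_split f \<longleftrightarrow>
    (\<exists>\<phi>.
      (\<forall>U. open_subset f U \<longrightarrow>
        \<phi> U \<in> carrier (sections f U) \<rightarrow> carrier (sections f U) \<and>
        (\<forall>\<sigma> \<in> carrier (sections f U). \<forall>\<tau> \<in> carrier (sections f U).
          \<phi> U (\<sigma> \<oplus>\<^bsub>sections f U\<^esub> \<tau>) = \<phi> U \<sigma> \<oplus>\<^bsub>sections f U\<^esub> \<phi> U \<tau> \<and>
          \<phi> U ((\<sigma> [^]\<^bsub>sections f U\<^esub> CHAR('k)) \<otimes>\<^bsub>sections f U\<^esub> \<tau>)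
            = \<sigma> \<otimes>\<^bsub>sections f U\<^esub> \<phi> U \<tau>) \<and>
        (\<forall>\<sigma> \<in> carrier (sections f U).
          \<phi> U (\<sigma> [^]\<^bsub>sections f U\<^esub> CHAR('k)) = \<sigma>)) \<and>
      (\<forall>U V. open_subset f U \<and> open_subset f V \<and> V \<subseteq> U \<longrightarrow>
        (\<forall>\<sigma> \<in> carrier (sections f U). \<phi> V (restrict \<sigma> V) = restrict (\<phi> U \<sigma>) V)))"


section \<open>Classical projective space with homogeneous coordinates\<close>

definition proj_point :: "('k::field) ^ 'i \<Rightarrow> ('k ^ 'i) set"
  where "proj_point v = {c *s v | c. c \<noteq> 0}"

definition proj_space :: "(('k::field) ^ 'i) set set"
  where "proj_space = {proj_point v | v. v \<noteq> 0}"

definition proj_zariski_closed :: "(('k::field) ^ 'i::finite) set set \<Rightarrow> bool"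
  where "proj_zariski_closed Z \<longleftrightarrow>
    (\<exists>T :: ('i, 'k) mpoly set. (\<forall>g\<in>T. \<exists>d. homogeneous d g) \<and>
      Z = {proj_point v | v. v \<noteq> 0 \<and> (\<forall>g\<in>T. eval_mpoly v g = 0)})"

definition proj_zariski_open :: "(('k::field) ^ 'i::finite) set set \<Rightarrow> bool"
  where "proj_zariski_open U \<longleftrightarrow> U \<subseteq> proj_space \<and> proj_zariski_closed (proj_space - U)"

text \<open>The projectivization of a linear subspace \<open>W\<close> has codimension
  \<open>(CARD('i) - 1) - (dim W - 1)\<close>.\<close>

definition proj_linear_subspace :: "nat \<Rightarrow> (('k::field) ^ 'i::finite) set set \<Rightarrow> bool"
  where "proj_linear_subspace codim L \<longleftrightarrow>
    (\<exists>W. vec.subspace W \<and> vec.dim W + codim = CARD('i) \<and>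
      L = {proj_point v | v. v \<noteq> 0 \<and> v \<in> W})"


section \<open>Cubic forms in four variables in terms of their twenty coordinates\<close>

text \<open>The index type \<open>4\<close> consists of the residues modulo 4, so its numeral \<open>4\<close> denotes the same
  element as \<open>0\<close>, and \<open>1, 2, 3, 4\<close> are its four distinct elements.\<close>

type_synonym cubic_index = "(4 \<times> 4) + 4"

abbreviation a_coord :: "'k ^ cubic_index \<Rightarrow> 4 \<Rightarrow> 4 \<Rightarrow> 'k"
  where "a_coord c i j \<equiv> c $ Inl (i, j)"

abbreviation b_coord :: "'k ^ cubic_index \<Rightarrow> 4 \<Rightarrow> 'k"
  where "b_coord c i \<equiv> c $ Inr i"

definition cubic_form :: "('k::field) ^ cubic_index \<Rightarrow> (4, 'k) mpoly"
  where "cubic_form c =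
    (let L = (\<lambda>i. \<Sum>j\<in>UNIV. Const (a_coord c i j) * X j); b = (\<lambda>i. Const (b_coord c i)) in
      X 1 ^ 2 * L 1 + X 2 ^ 2 * L 2 + X 3 ^ 2 * L 3 + X 4 ^ 2 * L 4
      + b 1 * X 2 * X 3 * X 4 + b 2 * X 1 * X 3 * X 4
      + b 3 * X 1 * X 2 * X 4 + b 4 * X 1 * X 2 * X 3)"

definition frobenius_split_cubics :: "(('k::field) ^ cubic_index) set set"
  where "frobenius_split_cubics =
    {proj_point c | c. c \<noteq> 0 \<and> frobenius_split (cubic_form c)}"

definition no_squarefree_part :: "(('k::field) ^ cubic_index) set set"
  where "no_squarefree_part =
    {proj_point c | c. c \<noteq> 0 \<and>
      b_coord c 1 = 0 \<and> b_coord c 2 = 0 \<and> b_coord c 3 = 0 \<and> b_coord c 4 = 0}"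

definition squarefree_monom :: "('n \<Rightarrow>\<^sub>0 nat) \<Rightarrow> bool"
  where "squarefree_monom m \<longleftrightarrow> (\<forall>i. Poly_Mapping.lookup m i \<le> 1)"

end

theory Submission
  imports Defs
begin

text \<open>
  Let \<open>S\<close> be the polynomial ring and \<open>f\<close> the cubic form. Both directions compare a splitting of the
  structure sheaf of \<open>X = Proj (S/f)\<close> with a graded splitting of \<open>S/f\<close>: an additive map \<open>\<theta>\<close> that
  halves degrees and satisfies \<open>\<theta> (a\<^sup>2 g) = a \<theta> g\<close> and \<open>\<theta> 1 = 1\<close>. This is Fedder's criterion;
  for the converse direction the part of \<open>\<theta>\<close> from quadratic to linear forms is enough.

  Let a square-free monomial occur in \<open>f\<close>. In characteristic two \<open>S\<close> is free over its squares on the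
  square-free monomials. The trace \<open>frobenius_trace\<close> reads off the coefficient at \<open>x\<^sub>1 x\<^sub>2 x\<^sub>3 x\<^sub>4\<close>
  in this basis. For a linear form \<open>h\<close> put \<open>\<theta> g = frobenius_trace (f h g)\<close>. It maps multiples of \<open>f\<close>
  to multiples of \<open>f\<close>, since \<open>f\<^sup>2\<close> comes out of the trace as \<open>f\<close>. As \<open>f h\<close> has degree 4,
  \<open>\<theta> 1\<close> is a constant, the square root of the coefficient of \<open>x\<^sub>1 x\<^sub>2 x\<^sub>3 x\<^sub>4\<close> in \<open>f h\<close>; when
  the coefficient of \<open>x\<^sub>1 x\<^sub>2 x\<^sub>3 x\<^sub>4 / x\<^sub>i\<close> in \<open>f\<close> is non-zero, a multiple \<open>h\<close> of \<open>x\<^sub>i\<close> makes it 1.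
  Finally \<open>a/s = a s/s\<^sup>2\<close> forces the formula \<open>a/s \<mapsto> \<theta> (a s)/s\<close> for the splitting of the sheaf
  (locale \<open>graded_splitting\<close>).

  Conversely let \<open>f = \<Sum>\<^sub>i x\<^sub>i\<^sup>2 L\<^sub>i\<close> with linear forms \<open>L\<^sub>i\<close>, and let \<open>\<phi>\<close> be a splitting of the sheaf.
  For a quadratic form \<open>q\<close> the local sections \<open>x\<^sub>j \<phi> (q/x\<^sub>j\<^sup>2)\<close> of \<open>O(1)\<close> agree on overlaps. A global
  section of \<open>O(1)\<close> on \<open>X\<close> is a linear form (\<open>twisted_global_sections\<close>), so they define a linear form
  \<open>\<theta> q\<close>. Then \<open>\<theta> (l\<^sup>2) = l\<close> for linear \<open>l\<close>, and \<open>\<Sum>\<^sub>i x\<^sub>i \<theta> (L\<^sub>i g) = 0\<close> for linear \<open>g\<close>, because the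
  left side stands for \<open>\<theta> (f g)\<close> and has degree less than 3. Let \<open>M\<^sub>g(i, c)\<close> be the coefficient of \<open>x\<^sub>c\<close>
  in \<open>\<theta> (L\<^sub>i g)\<close>. The second relation says that the matrix \<open>M\<^sub>g\<close> is alternating. By the first one, the
  coefficient of \<open>x\<^sub>c\<close> in \<open>L\<^sub>i\<close> is \<open>M\<^sub>g(i, c)\<close> for \<open>g = L\<^sub>i\<close>, and up to sign this is
  \<open>M\<^sub>g(c, i)\<close>, the coefficient of \<open>x\<^sub>i\<close> in \<open>\<theta> (L\<^sub>c L\<^sub>i)\<close>. That coefficient lies on the diagonal of \<open>M\<^sub>g\<close>
  for \<open>g = L\<^sub>c\<close>, so it is zero. Hence all \<open>L\<^sub>i\<close> vanish and \<open>f = 0\<close>, a contradiction.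

  The computation of the sections of \<open>O(1)\<close> uses the usual two ingredients: compactness of \<open>X\<close>,
  which comes from the existence of homogeneous primes avoiding the powers of a form
  (\<open>exists_homogeneous_prime_avoiding\<close>), and the regularity of the sequence of three powers of
  variables, which makes the first Koszul relation liftable modulo \<open>f\<close> (\<open>koszul_lift\<close>).
\<close>

abbreviation (input) coeff_at where "coeff_at \<equiv> Poly_Mapping.lookup"

section \<open>Polynomials and their homogeneous components\<close>

lemma monom_degree_add [simp]: "monom_degree (m + n) = monom_degree m + monom_degree n"
  by (simp add: monom_degree_def lookup_add sum.distrib)

lemma monom_degree_single [simp]: "monom_degree (Poly_Mapping.single i n) = n"
  by (simp add: monom_degree_def lookup_single when_def)

lemma homogeneousD:
  assumes "homogeneous d g" "coeff_at g m \<noteq> 0"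
  shows "monom_degree m = d"
  using assms by (auto simp: homogeneous_def in_keys_iff)

lemma homogeneousI:
  assumes "\<And>m. coeff_at g m \<noteq> 0 \<Longrightarrow> monom_degree m = d"
  shows "homogeneous d g"
  using assms by (auto simp: homogeneous_def in_keys_iff)

lemma homogeneous_zero [simp]: "homogeneous d 0"
  by (simp add: homogeneous_def)

lemma homogeneous_single:
  "monom_degree m = d \<Longrightarrow> homogeneous d (Poly_Mapping.single m c)"
  by (rule homogeneousI) (auto simp: lookup_single when_def split: if_splits)

lemma homogeneous_one [simp]: "homogeneous 0 1"
  using homogeneous_single[of 0 0 1] by (simp add: monom_degree_def)

lemma homogeneous_Const [simp]: "homogeneous 0 (Const c)"
  unfolding Const_def by (rule homogeneous_single) (simp add: monom_degree_def)

lemma homogeneous_X [simp]: "homogeneous (Suc 0) (X i)"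
  unfolding X_def by (rule homogeneous_single) simp

lemma homogeneous_add:
  assumes "homogeneous d g" "homogeneous d h"
  shows "homogeneous d (g + h)"
proof (rule homogeneousI)
  fix m assume "coeff_at (g + h) m \<noteq> 0"
  then have "coeff_at g m \<noteq> 0 \<or> coeff_at h m \<noteq> 0"
    by (auto simp: lookup_add)
  then show "monom_degree m = d"
    using assms by (auto dest: homogeneousD)
qed

lemma homogeneous_uminus: "homogeneous d g \<Longrightarrow> homogeneous d (- g)"
  by (simp add: homogeneous_def in_keys_iff)

lemma homogeneous_diff: "homogeneous d g \<Longrightarrow> homogeneous d h \<Longrightarrow> homogeneous d (g - h)"
  using homogeneous_add[of d g "- h"] homogeneous_uminus[of d h] by simp

lemma homogeneous_sum: "(\<And>x. x \<in> A \<Longrightarrow> homogeneous d (g x)) \<Longrightarrow> homogeneous d (sum g A)"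
  by (induction A rule: infinite_finite_induct) (auto intro: homogeneous_add)

lemma homogeneous_mult:
  assumes "homogeneous d g" "homogeneous e h"
  shows "homogeneous (d + e) (g * h)"
  using keys_mult[of g h] assms by (fastforce simp: homogeneous_def)

lemma homogeneous_power: "homogeneous d g \<Longrightarrow> homogeneous (n * d) (g ^ n)"
  by (induction n) (auto intro: homogeneous_mult)

lemma homogeneous_X_power [simp]: "homogeneous n (X i ^ n)"
  using homogeneous_power[OF homogeneous_X, of n] by simp

lemma lookup_homogeneous_component:
  "coeff_at (homogeneous_component d g) m = (if monom_degree m = d then coeff_at g m else 0)"
proof -
  have "coeff_at (homogeneous_component d g) m =
      (\<Sum>m'\<in>{m \<in> Poly_Mapping.keys g. monom_degree m = d}. if m' = m then coeff_at g m else 0)"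
    unfolding homogeneous_component_def lookup_sum
    by (rule sum.cong) (auto simp: lookup_single when_def)
  also have "\<dots> = (if monom_degree m = d then coeff_at g m else 0)"
    by (simp add: in_keys_iff)
  finally show ?thesis .
qed

lemma homogeneous_homogeneous_component [simp]: "homogeneous d (homogeneous_component d g)"
  by (rule homogeneousI) (simp add: lookup_homogeneous_component split: if_splits)

lemma homogeneous_component_zero [simp]: "homogeneous_component d 0 = 0"
  by (rule poly_mapping_eqI) (simp add: lookup_homogeneous_component)

lemma homogeneous_component_add:
  "homogeneous_component d (g + h) = homogeneous_component d g + homogeneous_component d h"
  by (rule poly_mapping_eqI) (simp add: lookup_homogeneous_component lookup_add)

lemma homogeneous_component_diff:
  "homogeneous_component d (g - h) = homogeneous_component d g - homogeneous_component d h"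
  by (rule poly_mapping_eqI) (simp add: lookup_homogeneous_component lookup_minus)

lemma homogeneous_component_sum:
  "homogeneous_component d (sum g A) = (\<Sum>x\<in>A. homogeneous_component d (g x))"
  by (induction A rule: infinite_finite_induct) (auto simp: homogeneous_component_add)

lemma homogeneous_component_homogeneous:
  "homogeneous e g \<Longrightarrow> homogeneous_component d g = (if d = e then g else 0)"
  by (rule poly_mapping_eqI) (auto simp: lookup_homogeneous_component dest: homogeneousD)

lemma sum_homogeneous_components:
  assumes "finite D" "monom_degree ` Poly_Mapping.keys g \<subseteq> D"
  shows "(\<Sum>d\<in>D. homogeneous_component d g) = g"
proof (rule poly_mapping_eqI)
  fix m
  have "coeff_at (\<Sum>d\<in>D. homogeneous_component d g) m =
      (\<Sum>d\<in>D. if monom_degree m = d then coeff_at g m else 0)"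
    by (simp add: lookup_sum lookup_homogeneous_component)
  also have "\<dots> = coeff_at g m"
    using assms sum.delta'[of D "monom_degree m" "\<lambda>_. coeff_at g m"]
    by (cases "m \<in> Poly_Mapping.keys g") (auto simp: in_keys_iff)
  finally show "coeff_at (\<Sum>d\<in>D. homogeneous_component d g) m = coeff_at g m" .
qed

lemma homogeneous_component_mult_homogeneous:
  assumes "homogeneous e f"
  shows "homogeneous_component d (f * g) = (if e \<le> d then f * homogeneous_component (d - e) g else 0)"
proof -
  define D where "D = insert (d - e) (monom_degree ` Poly_Mapping.keys g)"
  have D: "finite D" by (simp add: D_def)
  have "f * g = (\<Sum>i\<in>D. f * homogeneous_component i g)"
    by (subst sum_homogeneous_components[OF D, of g, symmetric]) (auto simp: D_def sum_distrib_left)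
  then have "homogeneous_component d (f * g) =
      (\<Sum>i\<in>D. homogeneous_component d (f * homogeneous_component i g))"
    by (simp add: homogeneous_component_sum)
  also have "\<dots> = (\<Sum>i\<in>D. if d = e + i then f * homogeneous_component i g else 0)"
    by (rule sum.cong[OF refl], rule homogeneous_component_homogeneous,
        rule homogeneous_mult[OF assms]) simp
  also have "\<dots> = (\<Sum>i\<in>D. if d - e = i then (if e \<le> d then f * homogeneous_component i g else 0) else 0)"
    by (rule sum.cong) auto
  also have "\<dots> = (if e \<le> d then f * homogeneous_component (d - e) g else 0)"
    using D by (subst sum.delta') (auto simp: D_def)
  finally show ?thesis .
qed

lemma homogeneous_component_mult:
  "homogeneous_component n (g * h) =
    (\<Sum>i\<le>n. homogeneous_component i g * homogeneous_component (n - i) h)"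
proof -
  define D where "D = {..n} \<union> monom_degree ` Poly_Mapping.keys g"
  have D: "finite D" by (simp add: D_def)
  have "g * h = (\<Sum>i\<in>D. homogeneous_component i g * h)"
    by (subst sum_homogeneous_components[OF D, of g, symmetric]) (auto simp: D_def sum_distrib_right)
  then have "homogeneous_component n (g * h) = (\<Sum>i\<in>D. if i \<le> n
      then homogeneous_component i g * homogeneous_component (n - i) h else 0)"
    by (simp add: homogeneous_component_sum
        homogeneous_component_mult_homogeneous[OF homogeneous_homogeneous_component])
  also have "\<dots> = (\<Sum>i\<le>n. homogeneous_component i g * homogeneous_component (n - i) h)"
    using D by (intro sum.mono_neutral_cong_right) (auto simp: D_def)
  finally show ?thesis .
qed

lemma dvd_homogeneous_component:
  assumes "homogeneous e f" "f dvd g"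
  shows "f dvd homogeneous_component d g"
  using assms by (auto elim!: dvdE simp: homogeneous_component_mult_homogeneous)

text \<open>Equality modulo \<open>f\<close> is equality for forms of degree less than that of \<open>f\<close>. This is how identities
  between germs turn into identities between linear and quadratic forms.\<close>
lemma homogeneous_dvd_smaller_degree:
  assumes "homogeneous e f" "f dvd g" "homogeneous d g" "d < e"
  shows "g = 0"
proof -
  obtain r where "g = f * r" using assms by auto
  then have "homogeneous_component d g = 0"
    using assms by (simp add: homogeneous_component_mult_homogeneous)
  then show ?thesis using homogeneous_component_homogeneous[OF assms(3), of d] by simp
qed

section \<open>Divisibility by powers of the variables\<close>

lemma sum_monomials: "g = (\<Sum>m\<in>Poly_Mapping.keys g. Poly_Mapping.single m (coeff_at g m))"
  by (rule poly_mapping_eqI) (auto simp: lookup_sum lookup_single when_def in_keys_iff)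

lemma X_power: "X i ^ N = Poly_Mapping.single (Poly_Mapping.single i N) 1"
  by (induction N) (auto simp: X_def mult_single simp flip: single_add)

lemma lookup_single_mult:
  fixes g :: "('n, 'k::field) mpoly"
  shows "coeff_at (Poly_Mapping.single m c * g) (m + n) = c * coeff_at g n"
proof -
  have "Poly_Mapping.single m c * g =
      (\<Sum>l\<in>Poly_Mapping.keys g. Poly_Mapping.single (m + l) (c * coeff_at g l))"
    by (subst sum_monomials[of g]) (simp add: sum_distrib_left mult_single)
  then have "coeff_at (Poly_Mapping.single m c * g) (m + n) =
      (\<Sum>l\<in>Poly_Mapping.keys g. if l = n then c * coeff_at g n else 0)"
    by (auto simp: lookup_sum lookup_single when_def intro!: sum.cong)
  then show ?thesis by (auto simp: in_keys_iff)
qed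

lemma lookup_single_mult_eq_0:
  assumes "\<And>l. n \<noteq> m + l"
  shows "coeff_at (Poly_Mapping.single m c * g) n = 0"
proof (rule ccontr)
  assume "coeff_at (Poly_Mapping.single m c * g) n \<noteq> 0"
  then have "n \<in> Poly_Mapping.keys (Poly_Mapping.single m c * g)" by (simp add: in_keys_iff)
  with keys_mult[of "Poly_Mapping.single m c" g] assms show False
    by (auto split: if_splits)
qed

lemma lookup_X_power_mult:
  fixes g :: "('n, 'k::field) mpoly"
  shows "coeff_at (X i ^ N * g) (Poly_Mapping.single i N + n) = coeff_at g n"
  by (simp add: X_power lookup_single_mult)

lemma lookup_X_power_multD:
  assumes "coeff_at (X i ^ N * g) n \<noteq> 0"
  shows "N \<le> coeff_at n i"
proof -
  obtain l where "n = Poly_Mapping.single i N + l"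
    using assms lookup_single_mult_eq_0[of n "Poly_Mapping.single i N" 1 g] by (auto simp: X_power)
  then show ?thesis by (simp add: lookup_add)
qed

text \<open>A monomial ideal is spanned by monomials, so divisibility by a power of a variable can be tested
  on each monomial separately. The regularity of sequences of powers of variables reduces to this.\<close>
lemma X_power_dvdI:
  fixes g :: "('n, 'k::field) mpoly"
  assumes "\<And>n. coeff_at g n \<noteq> 0 \<Longrightarrow> N \<le> coeff_at n i"
  shows "X i ^ N dvd g"
proof -
  have "X i ^ N dvd Poly_Mapping.single m (coeff_at g m)" if "m \<in> Poly_Mapping.keys g" for m
  proof
    have "Poly_Mapping.single i N + (m - Poly_Mapping.single i N) = m"
      using assms[of m] that
      by (intro poly_mapping_eqI) (auto simp: lookup_add lookup_minus lookup_single when_def in_keys_iff)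
    then show "Poly_Mapping.single m (coeff_at g m) =
        X i ^ N * Poly_Mapping.single (m - Poly_Mapping.single i N) (coeff_at g m)"
      by (simp add: X_power mult_single)
  qed
  then show ?thesis
    by (subst sum_monomials[of g]) (rule dvd_sum)
qed

lemma X_power_regular:
  fixes a b :: "('n, 'k::field) mpoly"
  assumes "i \<noteq> j" "X j ^ N * a = X i ^ N * b"
  shows "X i ^ N dvd a"
proof (rule X_power_dvdI)
  fix n assume "coeff_at a n \<noteq> 0"
  then have "coeff_at (X i ^ N * b) (Poly_Mapping.single j N + n) \<noteq> 0"
    by (simp add: lookup_X_power_mult flip: assms(2))
  from lookup_X_power_multD[OF this] show "N \<le> coeff_at n i"
    using assms(1) by (simp add: lookup_add lookup_single)
qed

text \<open>Regularity of \<open>x\<^sub>i\<^sup>N, x\<^sub>j\<^sup>N, x\<^sub>k\<^sup>N\<close>: a monomial of \<open>e\<close> becomes divisible by \<open>x\<^sub>j\<^sup>N\<close> or \<open>x\<^sub>i\<^sup>N\<close> after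
  multiplication by \<open>x\<^sub>k\<^sup>N\<close> only if it was so before.\<close>
lemma X_power_regular2:
  fixes a b e :: "('n, 'k::field) mpoly"
  assumes "k \<noteq> i" "k \<noteq> j" "X k ^ N * e = X j ^ N * a + X i ^ N * b"
  shows "\<exists>c d. e = X j ^ N * c + X i ^ N * d"
proof -
  \<comment> \<open>The part \<open>e1\<close> collects the monomials divisible by \<open>X i ^ N\<close>.\<close>
  define K where "K = {n \<in> Poly_Mapping.keys e. N \<le> coeff_at n i}"
  define e1 where "e1 = (\<Sum>n\<in>K. Poly_Mapping.single n (coeff_at e n))"
  have e1: "coeff_at e1 n = (if N \<le> coeff_at n i then coeff_at e n else 0)" for n
    unfolding e1_def K_def by (auto simp: lookup_sum lookup_single when_def in_keys_iff)
  have "X i ^ N dvd e1"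
    by (rule X_power_dvdI) (auto simp: e1 split: if_splits)
  moreover have "X j ^ N dvd e - e1"
  proof (rule X_power_dvdI)
    fix n assume "coeff_at (e - e1) n \<noteq> 0"
    then have n: "coeff_at e n \<noteq> 0" "\<not> N \<le> coeff_at n i"
      by (auto simp: lookup_minus e1 split: if_splits)
    define m where "m = Poly_Mapping.single k N + n"
    have "coeff_at (X k ^ N * e) m \<noteq> 0"
      using n by (simp add: m_def lookup_X_power_mult)
    then have "coeff_at (X j ^ N * a) m \<noteq> 0 \<or> coeff_at (X i ^ N * b) m \<noteq> 0"
      unfolding assms(3) by (auto simp: lookup_add)
    then have "N \<le> coeff_at m j \<or> N \<le> coeff_at m i"
      by (blast dest: lookup_X_power_multD)
    then show "N \<le> coeff_at n j"
      using assms n by (auto simp: m_def lookup_add lookup_single)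
  qed
  moreover have "e = (e - e1) + e1" by simp
  ultimately show ?thesis unfolding dvd_def by metis
qed

lemma X_power_nonzero [simp]: "X i ^ N \<noteq> (0 :: ('n, 'k::field) mpoly)"
  unfolding X_power by (metis lookup_single_eq lookup_zero zero_neq_one)

text \<open>The ring \<open>S/f\<close> has depth at least one with respect to any two variables: if
  \<open>x\<^sub>i\<^sup>N h = f a\<close> and \<open>x\<^sub>j\<^sup>N h = f b\<close>, cancelling \<open>f\<close> gives \<open>x\<^sub>j\<^sup>N a = x\<^sub>i\<^sup>N b\<close>, hence \<open>x\<^sub>i\<^sup>N\<close> divides \<open>a\<close>.\<close>
lemma X_powers_regular_mod:
  fixes f h :: "('n::linorder, 'k::field) mpoly"
  assumes "i \<noteq> j" "f \<noteq> 0" "f dvd X i ^ N * h" "f dvd X j ^ N * h"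
  shows "f dvd h"
proof -
  obtain a b where ab: "X i ^ N * h = f * a" "X j ^ N * h = f * b"
    using assms(3,4) by (auto simp: dvd_def)
  have "f * (X j ^ N * a) = X j ^ N * (X i ^ N * h)" by (simp only: ab mult.left_commute)
  also have "\<dots> = f * (X i ^ N * b)" using ab(2) by (simp only: mult.left_commute)
  finally have "f * (X j ^ N * a) = f * (X i ^ N * b)" .
  then have "X j ^ N * a = X i ^ N * b" using assms(2) by simp
  then obtain c where "a = X i ^ N * c" using X_power_regular[OF assms(1)] by blast
  then have "X i ^ N * h = X i ^ N * (f * c)" using ab by (simp only: mult.left_commute)
  then have "h = f * c" by (meson X_power_nonzero mult_left_cancel)
  then show ?thesis by simp
qed

text \<open>Fractions \<open>G\<^sub>m/x\<^sub>m\<^sup>N\<close> that agree modulo \<open>f\<close> have a common numerator \<open>l\<close>; this is the vanishing of the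
  first local cohomology of \<open>S/f\<close> at three variables. Let \<open>f e\<close>, \<open>f e'\<close>, \<open>f e''\<close> be the three
  differences. Cancelling \<open>f\<close> from the cocycle identity between them puts \<open>x\<^sub>k\<^sup>N e\<close> into the ideal of
  \<open>x\<^sub>i\<^sup>N, x\<^sub>j\<^sup>N\<close>, so \<open>e\<close> is in it by regularity. Correcting \<open>G\<^sub>1\<close> and \<open>G\<^sub>2\<close> by multiples of \<open>f\<close> then makes
  \<open>x\<^sub>j\<^sup>N G\<^sub>1 = x\<^sub>i\<^sup>N G\<^sub>2\<close> hold in \<open>S\<close> itself.\<close>
lemma koszul_lift:
  fixes f G1 G2 G3 :: "('n::linorder, 'k::field) mpoly"
  assumes dist: "i \<noteq> j" "k \<noteq> i" "k \<noteq> j" and "f \<noteq> 0"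
    and ij: "f dvd X j ^ N * G1 - X i ^ N * G2"
    and ik: "f dvd X k ^ N * G1 - X i ^ N * G3"
    and jk: "f dvd X k ^ N * G2 - X j ^ N * G3"
  shows "\<exists>l. f dvd G1 - X i ^ N * l \<and> f dvd G2 - X j ^ N * l"
proof -
  obtain e where e: "X j ^ N * G1 - X i ^ N * G2 = f * e" using ij by (auto simp: dvd_def)
  obtain e' where e': "X k ^ N * G1 - X i ^ N * G3 = f * e'" using ik by (auto simp: dvd_def)
  obtain e'' where e'': "X k ^ N * G2 - X j ^ N * G3 = f * e''" using jk by (auto simp: dvd_def)
  have "f * (X k ^ N * e) = f * (X j ^ N * e' + X i ^ N * - e'')"
  proof -
    have "f * (X k ^ N * e) = X k ^ N * (X j ^ N * G1 - X i ^ N * G2)" by (simp add: e mult.left_commute)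
    also have "\<dots> = X j ^ N * (X k ^ N * G1 - X i ^ N * G3) - X i ^ N * (X k ^ N * G2 - X j ^ N * G3)"
      by (simp add: algebra_simps)
    also have "\<dots> = f * (X j ^ N * e' + X i ^ N * - e'')"
      unfolding e' e'' by (simp add: algebra_simps)
    finally show ?thesis .
  qed
  then have "X k ^ N * e = X j ^ N * e' + X i ^ N * - e''" using \<open>f \<noteq> 0\<close> mult_left_cancel by blast
  then obtain c d where cd: "e = X j ^ N * c + X i ^ N * d"
    using X_power_regular2[OF dist(2,3)] by blast
  have eq: "X j ^ N * (G1 - f * c) = X i ^ N * (G2 + f * d)"
    using e unfolding cd by (simp add: algebra_simps)
  then obtain l where l: "G1 - f * c = X i ^ N * l"
    using X_power_regular[OF dist(1)] by blast
  have "X i ^ N * (G2 + f * d) = X i ^ N * (X j ^ N * l)"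
    using eq unfolding l by (simp only: mult.left_commute)
  then have "G2 + f * d = X j ^ N * l" by (meson X_power_nonzero mult_left_cancel)
  then have "G1 - X i ^ N * l = f * c" "G2 - X j ^ N * l = f * (- d)"
    using l by (simp_all add: diff_eq_eq add.commute eq_diff_eq)
  then show ?thesis by (metis dvd_triv_left)
qed

section \<open>Homogeneous ideals and the points of a hypersurface\<close>

definition homogeneous_ideal :: "('n::finite, 'k::field) mpoly set \<Rightarrow> bool"
  where "homogeneous_ideal I \<longleftrightarrow>
    0 \<in> I \<and> (\<forall>g\<in>I. \<forall>h\<in>I. g + h \<in> I) \<and> (\<forall>g\<in>I. \<forall>r. r * g \<in> I) \<and>
    (\<forall>g\<in>I. \<forall>d. homogeneous_component d g \<in> I)"

lemma homogeneous_prime_iff: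
  "homogeneous_prime P \<longleftrightarrow>
    homogeneous_ideal P \<and> 1 \<notin> P \<and> (\<forall>g h. g * h \<in> P \<longrightarrow> g \<in> P \<or> h \<in> P)"
  by (auto simp: homogeneous_prime_def homogeneous_ideal_def)

context
  fixes I :: "('n::finite, 'k::field) mpoly set"
  assumes I: "homogeneous_ideal I"
begin

lemma ideal_zero: "0 \<in> I"
  and ideal_add: "g \<in> I \<Longrightarrow> h \<in> I \<Longrightarrow> g + h \<in> I"
  and ideal_mult: "g \<in> I \<Longrightarrow> r * g \<in> I"
  and ideal_component: "g \<in> I \<Longrightarrow> homogeneous_component d g \<in> I"
  using I by (auto simp: homogeneous_ideal_def)

lemma ideal_mult': "g \<in> I \<Longrightarrow> g * r \<in> I"
  using ideal_mult[of g r] by (simp add: mult.commute)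

lemma ideal_dvd: "g \<in> I \<Longrightarrow> g dvd h \<Longrightarrow> h \<in> I"
  by (auto elim!: dvdE intro: ideal_mult')

lemma ideal_diff: "g \<in> I \<Longrightarrow> h \<in> I \<Longrightarrow> g - h \<in> I"
  using ideal_add[of g "- h"] ideal_mult[of h "- 1"] by simp

lemma ideal_sum: "(\<And>x. x \<in> A \<Longrightarrow> g x \<in> I) \<Longrightarrow> sum g A \<in> I"
  by (induction A rule: infinite_finite_induct) (auto intro: ideal_zero ideal_add)

lemma homogeneous_ideal_sum_principal:
  assumes a: "homogeneous e a"
  shows "homogeneous_ideal {m + r * a | m r. m \<in> I}"
  unfolding homogeneous_ideal_def
proof (intro conjI ballI allI)
  show "0 \<in> {m + r * a | m r. m \<in> I}"
    using ideal_zero by (auto intro!: exI[of _ 0])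
next
  fix g h assume "g \<in> {m + r * a | m r. m \<in> I}" "h \<in> {m + r * a | m r. m \<in> I}"
  then obtain m r m' r' where "g = m + r * a" "h = m' + r' * a" "m \<in> I" "m' \<in> I" by auto
  then have "g + h = (m + m') + (r + r') * a" "m + m' \<in> I"
    by (auto simp: algebra_simps intro: ideal_add)
  then show "g + h \<in> {m + r * a | m r. m \<in> I}" by blast
next
  fix g s assume "g \<in> {m + r * a | m r. m \<in> I}"
  then obtain m r where "g = m + r * a" "m \<in> I" by auto
  then have "s * g = s * m + (s * r) * a" "s * m \<in> I"
    by (auto simp: distrib_left mult.assoc intro: ideal_mult)
  then show "s * g \<in> {m + r * a | m r. m \<in> I}" by blast
next
  fix g d assume "g \<in> {m + r * a | m r. m \<in> I}"
  then obtain m r where g: "g = m + r * a" "m \<in> I" by auto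
  define r' where "r' = (if e \<le> d then homogeneous_component (d - e) r else 0)"
  have "homogeneous_component d g = homogeneous_component d m + r' * a"
    unfolding g homogeneous_component_add mult.commute[of r a]
      homogeneous_component_mult_homogeneous[OF a] r'_def by (simp add: mult.commute)
  then show "homogeneous_component d g \<in> {m + r * a | m r. m \<in> I}"
    using ideal_component[OF g(2)] by blast
qed

text \<open>For a homogeneous ideal primality need only be tested on forms: if \<open>g\<close> and \<open>h\<close> lie outside the
  ideal, the component of \<open>g h\<close> in the sum of the top degrees of \<open>g\<close> and \<open>h\<close> modulo the ideal is,
  modulo the ideal, the product of the two top components.\<close>
lemma homogeneous_ideal_primeI:
  assumes one: "1 \<notin> I"
    and prime: "\<And>d e g h. homogeneous d g \<Longrightarrow> homogeneous e h \<Longrightarrow> g * h \<in> I \<Longrightarrow> g \<in> I \<or> h \<in> I"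
  shows "homogeneous_prime I"
  unfolding homogeneous_prime_iff
proof (intro conjI allI impI I one, rule ccontr)
  fix g h assume gh: "g * h \<in> I" and "\<not> (g \<in> I \<or> h \<in> I)"
  then have notin: "g \<notin> I" "h \<notin> I" by auto
  define top where "top g = Max {d. homogeneous_component d g \<notin> I}" for g
  have fin: "finite {d. homogeneous_component d g \<notin> I}" for g
  proof (rule finite_subset)
    show "{d. homogeneous_component d g \<notin> I} \<subseteq> monom_degree ` Poly_Mapping.keys g"
    proof
      fix d assume "d \<in> {d. homogeneous_component d g \<notin> I}"
      then have "homogeneous_component d g \<noteq> 0" using ideal_zero by auto
      then obtain m where "coeff_at (homogeneous_component d g) m \<noteq> 0"
        by (metis poly_mapping_eqI lookup_zero)
      then show "d \<in> monom_degree ` Poly_Mapping.keys g"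
        by (auto simp: lookup_homogeneous_component in_keys_iff split: if_splits)
    qed
  qed simp
  have ne: "{d. homogeneous_component d g \<notin> I} \<noteq> {}" if "g \<notin> I" for g
  proof
    assume "{d. homogeneous_component d g \<notin> I} = {}"
    then have "(\<Sum>d\<in>monom_degree ` Poly_Mapping.keys g. homogeneous_component d g) \<in> I"
      by (intro ideal_sum) auto
    with that show False by (simp add: sum_homogeneous_components)
  qed
  have top: "homogeneous_component (top g) g \<notin> I" if "g \<notin> I" for g
    using Max_in[OF fin ne[OF that]] by (simp add: top_def)
  have above: "homogeneous_component d g \<in> I" if "d > top g" for d g
    using Max_ge[OF fin, of d g] that by (auto simp: top_def)
  let ?n = "top g + top h"
  let ?p = "\<lambda>i. homogeneous_component i g * homogeneous_component (?n - i) h"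
  have split: "homogeneous_component ?n (g * h) = ?p (top g) + (\<Sum>i\<in>{..?n} - {top g}. ?p i)"
    unfolding homogeneous_component_mult by (rule sum.remove) auto
  have "(\<Sum>i\<in>{..?n} - {top g}. ?p i) \<in> I"
  proof (rule ideal_sum)
    fix i assume i: "i \<in> {..?n} - {top g}"
    show "?p i \<in> I"
    proof (cases "i < top g")
      case True
      then show ?thesis by (intro ideal_mult above) auto
    next
      case False
      with i show ?thesis by (intro ideal_mult' above) auto
    qed
  qed
  moreover have "homogeneous_component ?n (g * h) \<in> I" by (rule ideal_component[OF gh])
  ultimately have "homogeneous_component ?n (g * h) - (\<Sum>i\<in>{..?n} - {top g}. ?p i) \<in> I"
    by (intro ideal_diff)
  then have "?p (top g) \<in> I" unfolding split by simp
  then show False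
    using prime[OF homogeneous_homogeneous_component homogeneous_homogeneous_component]
      top[OF notin(1)] top[OF notin(2)] by auto
qed

end

text \<open>An ideal \<open>M\<close> that is maximal among the homogeneous ideals over \<open>I\<close> without powers of \<open>h\<close> is prime:
  if the forms \<open>a\<close> and \<open>b\<close> are outside, adding either of them produces a power of \<open>h\<close>, and the product
  of these two powers lies in the ideal generated by \<open>M\<close> and \<open>a b\<close>.\<close>
lemma exists_homogeneous_prime_avoiding:
  fixes h :: "('n::finite, 'k::field) mpoly"
  assumes I: "homogeneous_ideal I" and h: "\<And>n. h ^ n \<notin> I"
  shows "\<exists>P. homogeneous_prime P \<and> I \<subseteq> P \<and> h \<notin> P"
proof -
  define \<A> where "\<A> = {K. homogeneous_ideal K \<and> I \<subseteq> K \<and> (\<forall>n. h ^ n \<notin> K)}"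
  have "\<exists>M\<in>\<A>. \<forall>K\<in>\<A>. M \<subseteq> K \<longrightarrow> K = M"
  proof (rule subset_Zorn_nonempty)
    show "\<A> \<noteq> {}" using I h by (auto simp: \<A>_def)
  next
    fix \<C> assume ne: "\<C> \<noteq> {}" and chain: "subset.chain \<A> \<C>"
    have mem: "K \<in> \<C> \<Longrightarrow> homogeneous_ideal K \<and> I \<subseteq> K \<and> (\<forall>n. h ^ n \<notin> K)" for K
      using chain by (auto simp: subset_chain_def \<A>_def)
    have "homogeneous_ideal (\<Union>\<C>)"
      unfolding homogeneous_ideal_def
    proof (intro conjI ballI allI)
      show "0 \<in> \<Union>\<C>" using ne mem ideal_zero by blast
    next
      fix a b assume "a \<in> \<Union>\<C>" "b \<in> \<Union>\<C>"
      then obtain K L where KL: "K \<in> \<C>" "a \<in> K" "L \<in> \<C>" "b \<in> L" by blast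
      moreover have "K \<subseteq> L \<or> L \<subseteq> K" using chain KL by (simp add: subset_chain_def)
      ultimately obtain K where "K \<in> \<C>" "a \<in> K" "b \<in> K" by blast
      then show "a + b \<in> \<Union>\<C>" using mem ideal_add by blast
    next
      fix a r assume "a \<in> \<Union>\<C>"
      then show "r * a \<in> \<Union>\<C>" using mem ideal_mult by blast
    next
      fix a d assume "a \<in> \<Union>\<C>"
      then show "homogeneous_component d a \<in> \<Union>\<C>" using mem ideal_component by blast
    qed
    then show "\<Union>\<C> \<in> \<A>" using mem ne by (auto simp: \<A>_def)
  qed
  then obtain M where M: "homogeneous_ideal M" "I \<subseteq> M" "\<And>n. h ^ n \<notin> M"
    and max: "\<And>K. K \<in> \<A> \<Longrightarrow> M \<subseteq> K \<Longrightarrow> K = M"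
    by (auto simp: \<A>_def)
  have power: "\<exists>n r m. m \<in> M \<and> h ^ n = m + r * a" if "homogeneous d a" "a \<notin> M" for a d
  proof -
    define K where "K = {m + r * a | m r. m \<in> M}"
    have K: "homogeneous_ideal K"
      unfolding K_def by (rule homogeneous_ideal_sum_principal[OF M(1) that(1)])
    have MK: "M \<subseteq> K"
    proof
      fix m assume "m \<in> M"
      then have "m + 0 * a \<in> K" unfolding K_def by blast
      then show "m \<in> K" by simp
    qed
    have "0 + 1 * a \<in> K" unfolding K_def using ideal_zero[OF M(1)] by blast
    then have "K \<noteq> M" using that by auto
    then have "K \<notin> \<A>" using max MK by blast
    then have "\<exists>n. h ^ n \<in> K" using K MK M(2) by (auto simp: \<A>_def)
    then show ?thesis unfolding K_def by blast
  qed
  have "homogeneous_prime M"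
  proof (rule homogeneous_ideal_primeI[OF M(1)])
    show "1 \<notin> M" using M(3)[of 0] by simp
  next
    fix d e a b assume ab: "homogeneous d a" "homogeneous e b" "a * b \<in> M"
    show "a \<in> M \<or> b \<in> M"
    proof (rule ccontr)
      assume "\<not> (a \<in> M \<or> b \<in> M)"
      then obtain n r m n' r' m' where "m \<in> M" "h ^ n = m + r * a" "m' \<in> M" "h ^ n' = m' + r' * b"
        using power ab(1,2) by meson
      then have "h ^ (n + n') = m * h ^ n' + (r * a) * m' + (r * r') * (a * b)"
        by (simp add: power_add algebra_simps)
      also have "\<dots> \<in> M"
        by (rule ideal_add[OF M(1) ideal_add[OF M(1)]])
          (simp_all add: ideal_mult[OF M(1)] ideal_mult'[OF M(1)] \<open>m \<in> M\<close> \<open>m' \<in> M\<close> ab(3))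
      finally show False using M(3) by blast
    qed
  qed
  then show ?thesis using M(2) M(3)[of 1] by auto
qed

context
  fixes P :: "('n::finite, 'k::field) mpoly set"
  assumes P: "homogeneous_prime P"
begin

lemma prime_homogeneous_ideal: "homogeneous_ideal P"
  using P by (simp add: homogeneous_prime_iff)

lemma prime_mult_notin: "g \<notin> P \<Longrightarrow> h \<notin> P \<Longrightarrow> g * h \<notin> P"
  using P by (auto simp: homogeneous_prime_iff)

lemma prime_one_notin: "1 \<notin> P"
  using P by (simp add: homogeneous_prime_iff)

lemma prime_power_notin: "g \<notin> P \<Longrightarrow> g ^ n \<notin> P"
  by (induction n) (auto simp: prime_one_notin dest: prime_mult_notin[rotated])

end

lemma pointsD:
  assumes "P \<in> points f"
  shows "homogeneous_prime P" "f \<in> P" "\<exists>i. X i \<notin> P"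
  using assms by (auto simp: points_def)

text \<open>A form that vanishes in every stalk over the open set \<open>v \<noteq> 0\<close> is killed by a power of \<open>v\<close> modulo
  \<open>f\<close>: otherwise a homogeneous prime over its annihilator avoids \<open>v\<close>, and at the corresponding point
  the form is not zero. That \<open>v\<close> lies in every prime over the irrelevant ideal makes this prime a
  point of the projective scheme.\<close>
lemma power_annihilates:
  fixes f g v :: "('n::finite, 'k::field) mpoly"
  assumes f: "homogeneous d f" and g: "homogeneous e g"
    and v: "\<And>P. homogeneous_prime P \<Longrightarrow> range X \<subseteq> P \<Longrightarrow> v \<in> P"
    and ann: "\<And>P. P \<in> points f \<Longrightarrow> v \<notin> P \<Longrightarrow> \<exists>u. u \<notin> P \<and> f dvd u * g"
  shows "\<exists>N. f dvd v ^ N * g"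
proof (rule ccontr)
  assume no: "\<nexists>N. f dvd v ^ N * g"
  define I where "I = {u. f dvd u * g}"
  have "homogeneous_ideal I"
    unfolding homogeneous_ideal_def I_def
  proof (intro conjI ballI allI; clarsimp)
    show "f dvd (a + b) * g" if "f dvd a * g" "f dvd b * g" for a b
      using that by (simp add: distrib_right)
    show "f dvd r * a * g" if "f dvd a * g" for a r
      using that by (simp add: mult.assoc)
    show "f dvd homogeneous_component i a * g" if "f dvd a * g" for a i
    proof -
      have "homogeneous_component i a * g = homogeneous_component (e + i) (g * a)"
        unfolding homogeneous_component_mult_homogeneous[OF g] by (simp add: mult.commute)
      then show ?thesis using dvd_homogeneous_component[OF f] that by (simp add: mult.commute)
    qed
  qed
  moreover have "v ^ N \<notin> I" for N using no by (simp add: I_def)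
  ultimately obtain P where P: "homogeneous_prime P" "I \<subseteq> P" "v \<notin> P"
    using exists_homogeneous_prime_avoiding by blast
  have "f \<in> I" by (simp add: I_def)
  then have "P \<in> points f" using P v by (auto simp: points_def)
  then show False using ann[of P] P by (auto simp: I_def)
qed

text \<open>The annihilator of such a form modulo \<open>f\<close> contains a power of every variable, and powers of two
  variables can be cancelled.\<close>
lemma vanishing_form:
  fixes f g :: "('n::{finite,linorder}, 'k::field) mpoly"
  assumes n: "i \<noteq> (j :: 'n)" and f: "homogeneous d f" "f \<noteq> 0" and g: "homogeneous e g"
    and ann: "\<And>P. P \<in> points f \<Longrightarrow> \<exists>u. u \<notin> P \<and> f dvd u * g"
  shows "f dvd g"
proof -
  have X: "\<exists>N. f dvd X k ^ N * g" for k
    by (rule power_annihilates[OF f(1) g]) (auto intro: ann)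
  obtain M N where MN: "f dvd X i ^ M * g" "f dvd X j ^ N * g" using X by blast
  have "f dvd X j ^ M * (X j ^ N * g)" "f dvd X i ^ N * (X i ^ M * g)"
    using MN by (auto intro: dvd_mult)
  then have "f dvd X i ^ (M + N) * g" "f dvd X j ^ (M + N) * g"
    by (simp_all only: power_add mult.assoc add.commute[of M N])
      (simp_all only: power_add mult.assoc mult.left_commute)
  then show ?thesis using X_powers_regular_mod[OF n f(2)] by blast
qed

text \<open>A commutative ring is a module over itself, and its submodules are its ideals. The rule
  that reassociates products is kept out of the simplifier, where it would fight associativity.\<close>
interpretation ideal: module "(*) :: 'a::comm_ring_1 \<Rightarrow> 'a \<Rightarrow> 'a"
  by unfold_locales (auto simp: algebra_simps)

declare ideal.scale_scale [simp del]

lemma homogeneous_ideal_span: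
  fixes T :: "('n::finite, 'k::field) mpoly set"
  assumes T: "\<And>t. t \<in> T \<Longrightarrow> \<exists>d. homogeneous d t"
  shows "homogeneous_ideal (ideal.span T)"
proof -
  have "homogeneous_component d g \<in> ideal.span T" if "g \<in> ideal.span T" for g d
    using that
  proof (induction rule: ideal.span_induct_alt)
    case base
    then show ?case by (simp add: ideal.span_zero)
  next
    case (step c x y)
    obtain e where e: "homogeneous e x" using T step by blast
    have "homogeneous_component (d - e) c * x \<in> ideal.span T"
      using step(1) by (intro ideal.span_scale ideal.span_base)
    then have "homogeneous_component d (c * x) \<in> ideal.span T"
      unfolding mult.commute[of c x] homogeneous_component_mult_homogeneous[OF e]
      by (simp add: ideal.span_zero mult.commute)
    then show ?case
      unfolding homogeneous_component_add by (rule ideal.span_add) (rule step.IH)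
  qed
  then show ?thesis
    by (auto simp: homogeneous_ideal_def ideal.span_zero ideal.span_add ideal.span_scale)
qed

text \<open>The projective Nullstellensatz: forms without common zero on the hypersurface generate an ideal
  modulo \<open>f\<close> that contains a power of the irrelevant ideal.\<close>
lemma empty_locus_powers:
  fixes f :: "('n::finite, 'k::field) mpoly"
  assumes f: "homogeneous d f" and T: "\<And>t. t \<in> T \<Longrightarrow> \<exists>d. homogeneous d t"
    and empty: "\<And>P. P \<in> points f \<Longrightarrow> \<not> T \<subseteq> P"
  shows "\<exists>M. \<forall>i. X i ^ M \<in> ideal.span (insert f T)"
proof -
  have I: "homogeneous_ideal (ideal.span (insert f T))"
    using f T by (intro homogeneous_ideal_span) auto
  have "\<exists>M. X i ^ M \<in> ideal.span (insert f T)" for i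
  proof (rule ccontr)
    assume "\<not> ?thesis"
    then obtain P where P: "homogeneous_prime P" "ideal.span (insert f T) \<subseteq> P" "X i \<notin> P"
      using exists_homogeneous_prime_avoiding[OF I] by blast
    then have "insert f T \<subseteq> P" using ideal.span_superset by blast
    then show False using empty[of P] P by (auto simp: points_def)
  qed
  then obtain M where M: "\<And>i. X i ^ M i \<in> ideal.span (insert f T)" by metis
  have "X i ^ (\<Sum>j\<in>UNIV. M j) \<in> ideal.span (insert f T)" for i
  proof -
    have "M i \<le> (\<Sum>j\<in>UNIV. M j)" by (rule member_le_sum) auto
    then show ?thesis by (metis M I ideal_dvd le_imp_power_dvd)
  qed
  then show ?thesis by blast
qed

text \<open>Quasi-compactness of the hypersurface: the powers of the variables are combinations of
  finitely many of the given forms.\<close>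
lemma finite_empty_locus:
  fixes f :: "('n::finite, 'k::field) mpoly"
  assumes f: "homogeneous d f" and T: "\<And>t. t \<in> T \<Longrightarrow> \<exists>d. homogeneous d t"
    and empty: "\<And>P. P \<in> points f \<Longrightarrow> \<not> T \<subseteq> P"
  shows "\<exists>T0. finite T0 \<and> T0 \<subseteq> T \<and> (\<forall>P\<in>points f. \<not> T0 \<subseteq> P)"
proof -
  obtain M where M: "\<And>i. X i ^ M \<in> ideal.span (insert f T)"
    using empty_locus_powers[OF assms] by blast
  have "\<exists>B. finite B \<and> B \<subseteq> insert f T \<and> X i ^ M \<in> ideal.span B" for i
  proof -
    obtain B r where B: "finite B" "B \<subseteq> insert f T" "X i ^ M = (\<Sum>b\<in>B. r b * b)"
      using M[of i] unfolding ideal.span_explicit by blast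
    have "X i ^ M \<in> ideal.span B"
      unfolding B(3) by (rule ideal.span_sum, rule ideal.span_scale, rule ideal.span_base)
    then show ?thesis using B(1,2) by blast
  qed
  then obtain B where B: "\<And>i. finite (B i)" "\<And>i. B i \<subseteq> insert f T" "\<And>i. X i ^ M \<in> ideal.span (B i)"
    by metis
  define T0 where "T0 = (\<Union>i. B i) \<inter> T"
  have "\<not> T0 \<subseteq> P" if P: "P \<in> points f" for P
  proof
    assume "T0 \<subseteq> P"
    obtain i where i: "X i \<notin> P" using pointsD(3)[OF P] by blast
    have I: "homogeneous_ideal P" using P by (simp add: pointsD prime_homogeneous_ideal)
    have "B i \<subseteq> P" using \<open>T0 \<subseteq> P\<close> B(2)[of i] pointsD(2)[OF P] by (auto simp: T0_def)
    moreover have "ideal.subspace P"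
      using I by (auto intro!: ideal.subspaceI ideal_zero ideal_add ideal_mult)
    ultimately have "X i ^ M \<in> P" using ideal.span_minimal B(3) by blast
    then show False using prime_power_notin[OF pointsD(1)[OF P] i] by blast
  qed
  then show ?thesis using B(1) by (intro exI[of _ T0]) (auto simp: T0_def)
qed

section \<open>Global sections of the twists of the structure sheaf\<close>

lemma span_finite_image:
  assumes "finite A" "x \<in> ideal.span (insert f (s ` A))"
  shows "\<exists>r c. x = (\<Sum>v\<in>A. r v * s v) + f * c"
  using assms
proof (induction A arbitrary: x rule: finite_induct)
  case empty
  then show ?case by (auto simp: ideal.span_singleton mult.commute)
next
  case (insert a A)
  then obtain k where "x - k * s a \<in> ideal.span (insert f (s ` A))"
    by (auto simp: insert_commute[of f] ideal.span_insert[of "s a"])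
  then obtain r c where rc: "x - k * s a = (\<Sum>v\<in>A. r v * s v) + f * c"
    using insert.IH by blast
  have "(\<Sum>v\<in>A. (r(a := k)) v * s v) = (\<Sum>v\<in>A. r v * s v)"
    using insert.hyps by (intro sum.cong) auto
  then have "x = (\<Sum>v\<in>insert a A. (r(a := k)) v * s v) + f * c"
    using rc insert.hyps by (simp add: algebra_simps)
  then show ?case by blast
qed

text \<open>Sections given by fractions \<open>g\<^sub>v/s\<^sub>v\<close> that agree globally come from one polynomial \<open>l\<close>. Writing
  \<open>x\<^sub>m\<^sup>M\<close> as a combination of the \<open>s\<^sub>v\<close>, the same combination of the \<open>g\<^sub>v\<close> is a numerator over
  \<open>x\<^sub>m\<^sup>M\<close>, and these numerators have a common lift by \<open>koszul_lift\<close>. Two variables suffice to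
  cancel \<open>x\<^sub>m\<^sup>M\<close> again.\<close>
lemma lift_compatible_fractions:
  fixes f :: "('n::{finite,linorder}, 'k::field) mpoly"
  assumes A: "finite A" and dist: "i \<noteq> (j :: 'n)" "k \<noteq> i" "k \<noteq> j" and f: "f \<noteq> 0"
    and compat: "\<And>v w. v \<in> A \<Longrightarrow> w \<in> A \<Longrightarrow> f dvd g v * s w - g w * s v"
    and span: "\<And>m. X m ^ M \<in> ideal.span (insert f (s ` A))"
  shows "\<exists>l. \<forall>w\<in>A. f dvd l * s w - g w"
proof -
  have "\<exists>r c. X m ^ M = (\<Sum>v\<in>A. r v * s v) + f * c" for m
    using span_finite_image[OF A span] .
  then obtain r c where rc: "\<And>m. X m ^ M = (\<Sum>v\<in>A. r m v * s v) + f * c m" by metis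
  define G where "G m = (\<Sum>v\<in>A. r m v * g v)" for m
  have G: "f dvd G m * s w - X m ^ M * g w" if w: "w \<in> A" for m w
  proof -
    have "G m * s w - X m ^ M * g w =
        (\<Sum>v\<in>A. r m v * (g v * s w - g w * s v)) - f * (c m * g w)"
      unfolding rc G_def by (simp add: algebra_simps sum_distrib_left sum_distrib_right sum_subtractf)
    moreover have "f dvd (\<Sum>v\<in>A. r m v * (g v * s w - g w * s v))"
      using compat w by (intro dvd_sum dvd_mult) auto
    ultimately show ?thesis by (simp add: dvd_diff)
  qed
  have GG: "f dvd X n ^ M * G m - X m ^ M * G n" for m n
  proof -
    have "X n ^ M * G m - X m ^ M * G n =
        (\<Sum>v\<in>A. r n v * (G m * s v - X m ^ M * g v)) + f * (c n * G m)"
      unfolding rc[of n] G_def[of n]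
      by (simp add: algebra_simps sum_distrib_left sum_distrib_right sum_subtractf)
    moreover have "f dvd (\<Sum>v\<in>A. r n v * (G m * s v - X m ^ M * g v))"
      using G by (intro dvd_sum dvd_mult) auto
    ultimately show ?thesis by simp
  qed
  obtain l where l: "f dvd G i - X i ^ M * l" "f dvd G j - X j ^ M * l"
    using koszul_lift[OF dist f GG GG GG] by blast
  have "f dvd l * s w - g w" if w: "w \<in> A" for w
  proof (rule X_powers_regular_mod[OF dist(1) f])
    have *: "f dvd X m ^ M * (l * s w - g w)" if "f dvd G m - X m ^ M * l" for m
    proof -
      have "X m ^ M * (l * s w - g w) =
          (G m * s w - X m ^ M * g w) - s w * (G m - X m ^ M * l)"
        by (simp add: algebra_simps)
      then show ?thesis using G[OF w] that by (simp add: dvd_diff)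
    qed
    show "f dvd X i ^ M * (l * s w - g w)" "f dvd X j ^ M * (l * s w - g w)"
      using * l by blast+
  qed
  then show ?thesis by blast
qed

text \<open>On a hypersurface in at least three variables every global section of \<open>O(e)\<close> is a form of
  degree \<open>e\<close>. A section is a family of fractions \<open>b Q/t Q\<close> in the stalks which near each point is
  given by one fraction \<open>a/s\<close> whose degrees differ by \<open>e\<close>. Finitely many such fractions suffice; a
  common power \<open>K\<close> of the forms \<open>v\<close> defining their domains, multiplied into numerators and
  denominators, makes all of them agree modulo \<open>f\<close>, and then they lift.\<close>
theorem twisted_global_sections:
  fixes f :: "('n::{finite,linorder}, 'k::field) mpoly"
  assumes dist: "i \<noteq> (j :: 'n)" "k \<noteq> i" "k \<noteq> j" and f: "homogeneous df f" "f \<noteq> 0"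
    and den: "\<And>P. P \<in> points f \<Longrightarrow> t P \<notin> P"
    and local: "\<And>P. P \<in> points f \<Longrightarrow> \<exists>v dv a s d. homogeneous dv v \<and> v \<notin> P \<and>
      homogeneous (d + e) a \<and> homogeneous d s \<and> (\<forall>Q\<in>points f. v \<notin> Q \<longrightarrow> s \<notin> Q \<and>
        (\<exists>u. u \<notin> Q \<and> f dvd u * (b Q * s - a * t Q)))"
  shows "\<exists>l. homogeneous e l \<and> (\<forall>Q\<in>points f. \<exists>u. u \<notin> Q \<and> f dvd u * (b Q - l * t Q))"
proof -
  define chart where "chart v dv a s d \<longleftrightarrow> homogeneous dv v \<and>
      (\<forall>P. homogeneous_prime P \<and> range X \<subseteq> P \<longrightarrow> v \<in> P) \<and>
      homogeneous (d + e) a \<and> homogeneous d s \<and> (\<forall>Q\<in>points f. v \<notin> Q \<longrightarrow> s \<notin> Q \<and>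
        (\<exists>u. u \<notin> Q \<and> f dvd u * (b Q * s - a * t Q)))" for v dv a s d
  define T where "T = {v. \<exists>dv a s d. chart v dv a s d}"
  have T_hom: "\<exists>d. homogeneous d v" if "v \<in> T" for v
    using that by (auto simp: T_def chart_def)
  have cover: "\<not> T \<subseteq> P" if P: "P \<in> points f" for P
  proof -
    obtain v dv a s d where *: "homogeneous dv v" "v \<notin> P" "homogeneous (d + e) a" "homogeneous d s"
      "\<forall>Q\<in>points f. v \<notin> Q \<longrightarrow> s \<notin> Q \<and> (\<exists>u. u \<notin> Q \<and> f dvd u * (b Q * s - a * t Q))"
      using local[OF P] by (elim exE conjE)
    obtain m where m: "X m \<notin> P" using pointsD[OF P] by blast
    have X_in: "v * X m \<in> Q" if "homogeneous_prime Q" "X m \<in> Q" for Q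
      using that by (intro ideal_mult prime_homogeneous_ideal)
    have v_in: "v * X m \<in> Q" if "homogeneous_prime Q" "v \<in> Q" for Q
      using that by (intro ideal_mult' prime_homogeneous_ideal)
    \<comment> \<open>The factor \<open>X m\<close> puts the form into every prime over the irrelevant ideal.\<close>
    have "chart (v * X m) (dv + Suc 0) a s d"
      unfolding chart_def
    proof (intro conjI)
      show "homogeneous (dv + Suc 0) (v * X m)" using * by (intro homogeneous_mult homogeneous_X)
      show "\<forall>Q. homogeneous_prime Q \<and> range X \<subseteq> Q \<longrightarrow> v * X m \<in> Q" using X_in by blast
      show "\<forall>Q\<in>points f. v * X m \<notin> Q \<longrightarrow> s \<notin> Q \<and> (\<exists>u. u \<notin> Q \<and> f dvd u * (b Q * s - a * t Q))"
      proof (intro ballI impI)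
        fix Q assume Q: "Q \<in> points f" "v * X m \<notin> Q"
        then have "v \<notin> Q" using v_in pointsD(1) by blast
        then show "s \<notin> Q \<and> (\<exists>u. u \<notin> Q \<and> f dvd u * (b Q * s - a * t Q))"
          using *(5) Q(1) by (elim ballE[of _ _ Q]) simp_all
      qed
    qed (use * in auto)
    then have "v * X m \<in> T" unfolding T_def by blast
    moreover have "v * X m \<notin> P" using * m P by (intro prime_mult_notin pointsD)
    ultimately show ?thesis by blast
  qed
  have "\<exists>A. finite A \<and> A \<subseteq> T \<and> (\<forall>P\<in>points f. \<not> A \<subseteq> P)"
    by (rule finite_empty_locus[OF f(1)]) (erule T_hom, erule cover)
  then obtain A where A: "finite A" "A \<subseteq> T" "\<And>P. P \<in> points f \<Longrightarrow> \<not> A \<subseteq> P"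
    by blast
  have "\<forall>v\<in>A. \<exists>dv a s d. chart v dv a s d" using A by (auto simp: T_def)
  then obtain dv a s d where "\<forall>v\<in>A. chart v (dv v) (a v) (s v) (d v)"
    unfolding bchoice_iff by (elim exE)
  then have v: "\<And>v. v \<in> A \<Longrightarrow> homogeneous (dv v) v"
    and v_irr: "\<And>v P. v \<in> A \<Longrightarrow> homogeneous_prime P \<Longrightarrow> range X \<subseteq> P \<Longrightarrow> v \<in> P"
    and a: "\<And>v. v \<in> A \<Longrightarrow> homogeneous (d v + e) (a v)"
    and s: "\<And>v. v \<in> A \<Longrightarrow> homogeneous (d v) (s v)"
    and sQ: "\<And>v Q. v \<in> A \<Longrightarrow> Q \<in> points f \<Longrightarrow> v \<notin> Q \<Longrightarrow> s v \<notin> Q"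
    and uQ: "\<And>v Q. v \<in> A \<Longrightarrow> Q \<in> points f \<Longrightarrow> v \<notin> Q \<Longrightarrow>
      \<exists>u. u \<notin> Q \<and> f dvd u * (b Q * s v - a v * t Q)"
    by (simp_all add: chart_def)
  have overlap: "\<exists>N. f dvd (v * w) ^ N * (a v * s w - a w * s v)" if vw: "v \<in> A" "w \<in> A" for v w
  proof (rule power_annihilates[OF f(1)])
    show "homogeneous (d v + e + d w) (a v * s w - a w * s v)"
    proof (rule homogeneous_diff)
      show "homogeneous (d v + e + d w) (a v * s w)" using vw a s by (intro homogeneous_mult)
      have "homogeneous (d w + e + d v) (a w * s v)" using vw a s by (intro homogeneous_mult)
      then show "homogeneous (d v + e + d w) (a w * s v)" by (simp add: add_ac)
    qed
  next
    fix P :: "('n, 'k) mpoly set" assume "homogeneous_prime P" "range X \<subseteq> P"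
    then show "v * w \<in> P" using v_irr vw by (blast intro: ideal_mult prime_homogeneous_ideal)
  next
    fix Q assume Q: "Q \<in> points f" "v * w \<notin> Q"
    note pQ = pointsD(1)[OF Q(1)] and iQ = prime_homogeneous_ideal[OF pointsD(1)[OF Q(1)]]
    have "v \<notin> Q" "w \<notin> Q" using Q iQ by (blast intro: ideal_mult ideal_mult')+
    then obtain u u' where u: "u \<notin> Q" "f dvd u * (b Q * s v - a v * t Q)"
      and u': "u' \<notin> Q" "f dvd u' * (b Q * s w - a w * t Q)"
      using uQ vw Q by meson
    \<comment> \<open>Both fractions equal \<open>b Q/t Q\<close> at \<open>Q\<close>, so their difference vanishes there.\<close>
    have "(u * u' * t Q) * (a v * s w - a w * s v) =
        u * s v * (u' * (b Q * s w - a w * t Q)) - u' * s w * (u * (b Q * s v - a v * t Q))"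
      by (simp add: algebra_simps)
    then have "f dvd (u * u' * t Q) * (a v * s w - a w * s v)"
      using dvd_diff[OF dvd_mult[OF u'(2), of "u * s v"] dvd_mult[OF u(2), of "u' * s w"]]
      by (simp only:)
    moreover have "u * u' * t Q \<notin> Q"
      using u u' den[OF Q(1)] by (intro prime_mult_notin[OF pQ])
    ultimately show "\<exists>u. u \<notin> Q \<and> f dvd u * (a v * s w - a w * s v)" by blast
  qed
  then obtain N where N: "\<And>v w. v \<in> A \<Longrightarrow> w \<in> A \<Longrightarrow> f dvd (v * w) ^ N v w * (a v * s w - a w * s v)"
    by metis
  \<comment> \<open>Any common upper bound of the finitely many exponents will do.\<close>
  define K where "K = (\<Sum>(v, w)\<in>A \<times> A. N v w)"
  have K: "f dvd (v * w) ^ K * (a v * s w - a w * s v)" if "v \<in> A" "w \<in> A" for v w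
  proof -
    have "N v w \<le> K"
      unfolding K_def using that A by (intro member_le_sum[of "(v, w)" _ "\<lambda>(v, w). N v w", simplified]) auto
    then have "(v * w) ^ N v w * (a v * s w - a w * s v) dvd (v * w) ^ K * (a v * s w - a w * s v)"
      by (intro mult_dvd_mono le_imp_power_dvd) auto
    then show ?thesis using N[OF that] dvd_trans by blast
  qed
  define s' where "s' v = s v * v ^ K" for v
  define g where "g v = a v * v ^ K" for v
  have compat: "f dvd g v * s' w - g w * s' v" if "v \<in> A" "w \<in> A" for v w
  proof -
    have "g v * s' w - g w * s' v = (v * w) ^ K * (a v * s w - a w * s v)"
      by (simp add: g_def s'_def power_mult_distrib algebra_simps)
    then show ?thesis using K[OF that] by simp
  qed
  have s'Q: "s' v \<notin> Q" if "v \<in> A" "Q \<in> points f" "v \<notin> Q" for v Q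
    unfolding s'_def using that sQ pointsD(1) by (intro prime_mult_notin prime_power_notin) auto
  have s': "homogeneous (d v + K * dv v) (s' v)" if "v \<in> A" for v
    unfolding s'_def using that by (intro homogeneous_mult homogeneous_power s v)
  have g: "homogeneous (d v + K * dv v + e) (g v)" if "v \<in> A" for v
  proof -
    have "homogeneous (d v + e + K * dv v) (g v)"
      unfolding g_def using that by (intro homogeneous_mult homogeneous_power a v)
    then show ?thesis by (simp add: add_ac)
  qed
  have "\<not> s' ` A \<subseteq> Q" if Q: "Q \<in> points f" for Q
    using A(3)[OF Q] s'Q[OF _ Q] by blast
  then obtain M where M: "\<And>m. X m ^ M \<in> ideal.span (insert f (s' ` A))"
    using empty_locus_powers[OF f(1), of "s' ` A"] s' by blast
  obtain l where l: "\<And>w. w \<in> A \<Longrightarrow> f dvd l * s' w - g w"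
    using lift_compatible_fractions[OF A(1) dist f(2) compat M] by blast
  \<comment> \<open>Only the component of degree \<open>e\<close> matters, as the \<open>g w\<close> and \<open>s' w\<close> are forms.\<close>
  define l' where "l' = homogeneous_component e l"
  have l': "f dvd l' * s' w - g w" if w: "w \<in> A" for w
  proof -
    let ?D = "d w + K * dv w"
    have "homogeneous_component (?D + e) (s' w * l - g w) = s' w * l' - g w"
      unfolding homogeneous_component_diff homogeneous_component_mult_homogeneous[OF s'[OF w]]
        homogeneous_component_homogeneous[OF g[OF w]] l'_def by simp
    then show ?thesis
      using dvd_homogeneous_component[OF f(1) l[OF w], of "?D + e"] by (simp add: mult.commute)
  qed
  have "\<exists>u. u \<notin> Q \<and> f dvd u * (b Q - l' * t Q)" if Q: "Q \<in> points f" for Q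
  proof -
    obtain w where w: "w \<in> A" "w \<notin> Q" using A(3)[OF Q] by blast
    note pQ = pointsD(1)[OF Q]
    obtain u where u: "u \<notin> Q" "f dvd u * (b Q * s w - a w * t Q)"
      using uQ w Q by blast
    have "(u * s' w) * (b Q - l' * t Q) =
        w ^ K * (u * (b Q * s w - a w * t Q)) - u * t Q * (l' * s' w - g w)"
      by (simp add: s'_def g_def algebra_simps)
    then have "f dvd (u * s' w) * (b Q - l' * t Q)"
      using dvd_diff[OF dvd_mult[OF u(2), of "w ^ K"] dvd_mult[OF l'[OF w(1)], of "u * t Q"]]
      by (simp only:)
    moreover have "u * s' w \<notin> Q" using u s'Q w Q by (intro prime_mult_notin[OF pQ]) auto
    ultimately show ?thesis by blast
  qed
  moreover have "homogeneous e l'" by (simp add: l'_def)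
  ultimately show ?thesis by blast
qed

section \<open>Germs and sections of the structure sheaf\<close>

lemma fractionsI: "s \<notin> P \<Longrightarrow> homogeneous d a \<Longrightarrow> homogeneous d s \<Longrightarrow> (a, s) \<in> fractions P"
  by (auto simp: fractions_def)

lemma fractionsE:
  assumes "(a, s) \<in> fractions P"
  obtains d where "s \<notin> P" "homogeneous d a" "homogeneous d s"
  using assms by (auto simp: fractions_def)

text \<open>The numerator of a difference of fractions of degree zero is again a form.\<close>
lemma homogeneous_cross_difference:
  assumes "homogeneous d a" "homogeneous d s" "homogeneous e b" "homogeneous e t"
  shows "homogeneous (d + e) (a * t - b * s)"
  using homogeneous_mult[OF assms(1,4)] homogeneous_mult[OF assms(3,2)]
  by (auto intro: homogeneous_diff simp: add.commute)

context
  fixes f :: "('n::finite, 'k::field) mpoly" and P :: "('n, 'k) mpoly set"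
  assumes P: "homogeneous_prime P"
begin

lemma fractions_mult:
  assumes "(a, s) \<in> fractions P" "(b, t) \<in> fractions P"
  shows "(a * b, s * t) \<in> fractions P"
proof -
  obtain d e where "s \<notin> P" "homogeneous d a" "homogeneous d s" "t \<notin> P" "homogeneous e b" "homogeneous e t"
    using assms by (elim fractionsE)
  then show ?thesis by (intro fractionsI[of _ _ "d + e"] homogeneous_mult prime_mult_notin P)
qed

lemma fractions_add:
  assumes "(a, s) \<in> fractions P" "(b, t) \<in> fractions P"
  shows "(a * t + b * s, s * t) \<in> fractions P"
proof -
  obtain d e where *: "s \<notin> P" "homogeneous d a" "homogeneous d s" "t \<notin> P" "homogeneous e b" "homogeneous e t"
    using assms by (elim fractionsE)
  then have "homogeneous (d + e) (a * t)" "homogeneous (e + d) (b * s)"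
    by (auto intro: homogeneous_mult)
  then have "homogeneous (d + e) (a * t + b * s)"
    by (auto intro: homogeneous_add simp: add.commute)
  then show ?thesis using * by (intro fractionsI[of _ _ "d + e"] homogeneous_mult prime_mult_notin P)
qed

lemma frac_relI:
  assumes "(a, s) \<in> fractions P" "(b, t) \<in> fractions P" "u \<notin> P" "homogeneous d u"
    "f dvd u * (a * t - b * s)"
  shows "((a, s), (b, t)) \<in> frac_rel f P"
  using assms unfolding frac_rel_def by blast

lemma frac_relE:
  assumes "((a, s), (b, t)) \<in> frac_rel f P"
  obtains u d where "(a, s) \<in> fractions P" "(b, t) \<in> fractions P" "u \<notin> P" "homogeneous d u"
    "f dvd u * (a * t - b * s)"
  using assms unfolding frac_rel_def by blast

lemma equiv_frac_rel: "equiv (fractions P) (frac_rel f P)"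
proof (rule equivI)
  show "frac_rel f P \<subseteq> fractions P \<times> fractions P" by (auto simp: frac_rel_def)
next
  show "refl_on (fractions P) (frac_rel f P)"
    by (rule refl_onI)
      (auto intro!: frac_relI[of _ _ _ _ 1 0] simp: prime_one_notin[OF P])
next
  show "sym (frac_rel f P)"
  proof (rule symI, clarify)
    fix a s b t assume "((a, s), (b, t)) \<in> frac_rel f P"
    then obtain u d where u: "(a, s) \<in> fractions P" "(b, t) \<in> fractions P" "u \<notin> P" "homogeneous d u"
      "f dvd u * (a * t - b * s)" by (rule frac_relE)
    have "u * (b * s - a * t) = - (u * (a * t - b * s))" by (simp add: algebra_simps)
    then have "f dvd u * (b * s - a * t)" using u(5) by (simp only: dvd_minus_iff)
    then show "((b, t), (a, s)) \<in> frac_rel f P" using u by (intro frac_relI)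
  qed
next
  show "trans (frac_rel f P)"
  proof (rule transI, clarify)
    fix a s b t c r assume "((a, s), (b, t)) \<in> frac_rel f P" "((b, t), (c, r)) \<in> frac_rel f P"
    then obtain u d w e where u: "(a, s) \<in> fractions P" "(b, t) \<in> fractions P" "u \<notin> P" "homogeneous d u"
      "f dvd u * (a * t - b * s)"
      and w: "(c, r) \<in> fractions P" "w \<notin> P" "homogeneous e w" "f dvd w * (b * r - c * t)"
      by (elim frac_relE)
    obtain i where t: "t \<notin> P" "homogeneous i t" using u(2) by (rule fractionsE)
    have "(u * w * t) * (a * r - c * s) =
        (w * r) * (u * (a * t - b * s)) + (u * s) * (w * (b * r - c * t))"
      by (simp add: algebra_simps)
    then have "f dvd (u * w * t) * (a * r - c * s)"
      using dvd_add[OF dvd_mult[OF u(5), of "w * r"] dvd_mult[OF w(4), of "u * s"]] by (simp only:)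
    moreover have "homogeneous (d + e + i) (u * w * t)" "u * w * t \<notin> P"
      using u w t by (auto intro: homogeneous_mult dest: prime_mult_notin[OF P, rotated])
    ultimately show "((a, s), (c, r)) \<in> frac_rel f P" using u(1) w(1) by (intro frac_relI)
  qed
qed

lemma frac_eq_iff:
  assumes "(a, s) \<in> fractions P" "(b, t) \<in> fractions P"
  shows "frac f P a s = frac f P b t \<longleftrightarrow> (\<exists>u d. homogeneous d u \<and> u \<notin> P \<and> f dvd u * (a * t - b * s))"
  unfolding frac_def eq_equiv_class_iff[OF equiv_frac_rel assms]
  using assms by (auto simp: frac_rel_def)

lemma frac_in_stalk: "(a, s) \<in> fractions P \<Longrightarrow> frac f P a s \<in> stalk f P"
  unfolding frac_def stalk_def by (rule quotientI)

lemma stalkE: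
  assumes "x \<in> stalk f P"
  obtains a s where "(a, s) \<in> fractions P" "x = frac f P a s"
  using assms unfolding stalk_def frac_def by (elim quotientE) auto

lemma mem_fracD:
  assumes "(a', s') \<in> frac f P a s"
  shows "((a, s), (a', s')) \<in> frac_rel f P"
  using assms by (simp add: frac_def)

lemma frac_self: "(a, s) \<in> fractions P \<Longrightarrow> (a, s) \<in> frac f P a s"
  using equiv_class_self[OF equiv_frac_rel] by (simp add: frac_def)

text \<open>An operation on germs that is defined as a union over representatives can be computed on
  any one of them, provided that it does not depend on the representative.\<close>
lemma UN_frac:
  assumes as: "(a, s) \<in> fractions P"
    and F: "\<And>a' s'. ((a, s), (a', s')) \<in> frac_rel f P \<Longrightarrow> F a' s' = F a s"
  shows "(\<Union>(a', s')\<in>frac f P a s. F a' s') = F a s"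
proof -
  have "F a' s' = F a s" if "(a', s') \<in> frac f P a s" for a' s'
    using that by (intro F mem_fracD)
  then show ?thesis
    by (intro equalityI subsetI) (auto intro!: bexI[OF _ frac_self[OF as]])
qed

lemma frac_mult_cong:
  assumes "((a, s), (a', s')) \<in> frac_rel f P" "((b, t), (b', t')) \<in> frac_rel f P"
  shows "frac f P (a' * b') (s' * t') = frac f P (a * b) (s * t)"
proof -
  obtain u d w e where u: "(a, s) \<in> fractions P" "(a', s') \<in> fractions P" "u \<notin> P" "homogeneous d u"
      "f dvd u * (a * s' - a' * s)"
    and w: "(b, t) \<in> fractions P" "(b', t') \<in> fractions P" "w \<notin> P" "homogeneous e w"
      "f dvd w * (b * t' - b' * t)"
    using assms by (elim frac_relE)
  have "(u * w) * ((a * b) * (s' * t') - (a' * b') * (s * t)) =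
      (w * b * t') * (u * (a * s' - a' * s)) + (u * a' * s) * (w * (b * t' - b' * t))"
    by (simp add: algebra_simps)
  then have "f dvd (u * w) * ((a * b) * (s' * t') - (a' * b') * (s * t))"
    using dvd_add[OF dvd_mult[OF u(5), of "w * b * t'"] dvd_mult[OF w(5), of "u * a' * s"]] by (simp only:)
  moreover have "homogeneous (d + e) (u * w)" "u * w \<notin> P"
    using u w by (auto intro: homogeneous_mult dest: prime_mult_notin[OF P, rotated])
  moreover have "(a * b, s * t) \<in> fractions P" "(a' * b', s' * t') \<in> fractions P"
    using u w by (auto intro: fractions_mult)
  ultimately show ?thesis by (subst eq_commute, subst frac_eq_iff) blast+
qed

lemma frac_add_cong:
  assumes "((a, s), (a', s')) \<in> frac_rel f P" "((b, t), (b', t')) \<in> frac_rel f P"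
  shows "frac f P (a' * t' + b' * s') (s' * t') = frac f P (a * t + b * s) (s * t)"
proof -
  obtain u d w e where u: "(a, s) \<in> fractions P" "(a', s') \<in> fractions P" "u \<notin> P" "homogeneous d u"
      "f dvd u * (a * s' - a' * s)"
    and w: "(b, t) \<in> fractions P" "(b', t') \<in> fractions P" "w \<notin> P" "homogeneous e w"
      "f dvd w * (b * t' - b' * t)"
    using assms by (elim frac_relE)
  have "(u * w) * ((a * t + b * s) * (s' * t') - (a' * t' + b' * s') * (s * t)) =
      (w * t * t') * (u * (a * s' - a' * s)) + (u * s * s') * (w * (b * t' - b' * t))"
    by (simp add: algebra_simps)
  then have "f dvd (u * w) * ((a * t + b * s) * (s' * t') - (a' * t' + b' * s') * (s * t))"
    using dvd_add[OF dvd_mult[OF u(5), of "w * t * t'"] dvd_mult[OF w(5), of "u * s * s'"]] by (simp only:)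
  moreover have "homogeneous (d + e) (u * w)" "u * w \<notin> P"
    using u w by (auto intro: homogeneous_mult dest: prime_mult_notin[OF P, rotated])
  moreover have "(a * t + b * s, s * t) \<in> fractions P" "(a' * t' + b' * s', s' * t') \<in> fractions P"
    using u w by (auto intro: fractions_add)
  ultimately show ?thesis by (subst eq_commute, subst frac_eq_iff) blast+
qed

lemma stalk_mult_frac:
  assumes "(a, s) \<in> fractions P" "(b, t) \<in> fractions P"
  shows "stalk_mult f P (frac f P a s) (frac f P b t) = frac f P (a * b) (s * t)"
proof -
  have r: "((a, s), (a, s)) \<in> frac_rel f P" "((b, t), (b, t)) \<in> frac_rel f P"
    using assms equiv_frac_rel by (auto simp: equiv_def refl_on_def)
  have inner: "(\<Union>(b', t')\<in>frac f P b t. frac f P (a' * b') (s' * t')) = frac f P (a' * b) (s' * t)"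
    if "((a, s), (a', s')) \<in> frac_rel f P" for a' s'
  proof (rule UN_frac[OF assms(2)])
    fix b' t' assume "((b, t), (b', t')) \<in> frac_rel f P"
    then show "frac f P (a' * b') (s' * t') = frac f P (a' * b) (s' * t)"
      using frac_mult_cong[OF that] frac_mult_cong[OF that r(2)] by metis
  qed
  have "(\<Union>(a', s')\<in>frac f P a s. \<Union>(b', t')\<in>frac f P b t. frac f P (a' * b') (s' * t')) =
      (\<Union>(b', t')\<in>frac f P b t. frac f P (a * b') (s * t'))"
    by (rule UN_frac[OF assms(1)]) (simp add: inner r frac_mult_cong[OF _ r(2)])
  then show ?thesis unfolding stalk_mult_def using inner[OF r(1)] by simp
qed

lemma stalk_add_frac:
  assumes "(a, s) \<in> fractions P" "(b, t) \<in> fractions P"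
  shows "stalk_add f P (frac f P a s) (frac f P b t) = frac f P (a * t + b * s) (s * t)"
proof -
  have r: "((a, s), (a, s)) \<in> frac_rel f P" "((b, t), (b, t)) \<in> frac_rel f P"
    using assms equiv_frac_rel by (auto simp: equiv_def refl_on_def)
  have inner: "(\<Union>(b', t')\<in>frac f P b t. frac f P (a' * t' + b' * s') (s' * t')) =
      frac f P (a' * t + b * s') (s' * t)"
    if "((a, s), (a', s')) \<in> frac_rel f P" for a' s'
  proof (rule UN_frac[OF assms(2)])
    fix b' t' assume "((b, t), (b', t')) \<in> frac_rel f P"
    then show "frac f P (a' * t' + b' * s') (s' * t') = frac f P (a' * t + b * s') (s' * t)"
      using frac_add_cong[OF that] frac_add_cong[OF that r(2)] by metis
  qed
  have "(\<Union>(a', s')\<in>frac f P a s. \<Union>(b', t')\<in>frac f P b t. frac f P (a' * t' + b' * s') (s' * t')) =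
      (\<Union>(b', t')\<in>frac f P b t. frac f P (a * t' + b' * s) (s * t'))"
    by (rule UN_frac[OF assms(1)]) (simp add: inner r frac_add_cong[OF _ r(2)])
  then show ?thesis unfolding stalk_add_def using inner[OF r(1)] by simp
qed

text \<open>The witness for equality of germs need not be homogeneous: one of its components is outside
  the prime as well, and it also annihilates the difference, which is a form.\<close>
lemma frac_eqI:
  assumes f: "homogeneous df f" and as: "(a, s) \<in> fractions P" and bt: "(b, t) \<in> fractions P"
    and u: "u \<notin> P" "f dvd u * (a * t - b * s)"
  shows "frac f P a s = frac f P b t"
proof -
  obtain d e where de: "homogeneous d a" "homogeneous d s" "homogeneous e b" "homogeneous e t"
    using as bt by (elim fractionsE)
  note h = homogeneous_cross_difference[OF de]
  have "\<exists>i. homogeneous_component i u \<notin> P"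
  proof (rule ccontr)
    assume "\<not> ?thesis"
    then have "(\<Sum>i\<in>monom_degree ` Poly_Mapping.keys u. homogeneous_component i u) \<in> P"
      by (intro ideal_sum[OF prime_homogeneous_ideal[OF P]]) auto
    with u show False by (simp add: sum_homogeneous_components)
  qed
  then obtain i where i: "homogeneous_component i u \<notin> P" by blast
  have "homogeneous_component (d + e + i) ((a * t - b * s) * u) =
      (a * t - b * s) * homogeneous_component i u"
    by (simp add: homogeneous_component_mult_homogeneous[OF h])
  then have "f dvd homogeneous_component i u * (a * t - b * s)"
    using dvd_homogeneous_component[OF f u(2), of "d + e + i"] by (simp add: mult.commute)
  then show ?thesis
    using frac_eq_iff[OF as bt] i homogeneous_homogeneous_component by blast
qed

lemma frac_cross_eq:
  assumes "(a, s) \<in> fractions P" "(b, t) \<in> fractions P" "a * t = b * s"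
  shows "frac f P a s = frac f P b t"
proof -
  have "f dvd 1 * (a * t - b * s)" using assms by simp
  then show ?thesis
    using frac_eq_iff[OF assms(1,2)] prime_one_notin[OF P] homogeneous_one by blast
qed

end

lemma open_subset_points: "open_subset f U \<Longrightarrow> P \<in> U \<Longrightarrow> P \<in> points f"
  by (auto simp: open_subset_def)

lemma open_subset_prime: "open_subset f U \<Longrightarrow> P \<in> U \<Longrightarrow> homogeneous_prime P"
  by (blast intro: open_subset_points pointsD)

definition basic_open :: "('n::finite, 'k::field) mpoly \<Rightarrow> ('n, 'k) mpoly \<Rightarrow> ('n, 'k) mpoly set set"
  where "basic_open f v = {P \<in> points f. v \<notin> P}"

lemma open_basic_open: "homogeneous d v \<Longrightarrow> open_subset f (basic_open f v)"
  unfolding open_subset_def basic_open_def by (intro exI[of _ "{v}"]) auto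

definition frac_section ::
    "('n::finite, 'k::field) mpoly \<Rightarrow> ('n, 'k) mpoly set set \<Rightarrow> ('n, 'k) mpoly \<Rightarrow> ('n, 'k) mpoly \<Rightarrow>
      (('n, 'k) mpoly set \<Rightarrow> ('n, 'k) germ)"
  where "frac_section f U a s = (\<lambda>P\<in>U. frac f P a s)"

lemma sections_germ:
  assumes "\<sigma> \<in> carrier (sections f U)" "P \<in> U" "open_subset f U"
  obtains a s where "(a, s) \<in> fractions P" "\<sigma> P = frac f P a s"
proof -
  have "\<sigma> P \<in> stalk f P" using assms(1,2) by (auto simp: sections_def PiE_iff)
  then show ?thesis using stalkE[OF open_subset_prime[OF assms(3,2)]] that by blast
qed

lemma sections_extensional:
  "\<sigma> \<in> carrier (sections f U) \<Longrightarrow> \<sigma> \<in> extensional U"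
  by (auto simp: sections_def PiE_iff)

lemma sections_locally_fraction:
  assumes "\<sigma> \<in> carrier (sections f U)" "P \<in> U"
  obtains v dv a s d where "homogeneous dv v" "v \<notin> P" "homogeneous d a" "homogeneous d s"
    "\<And>Q. Q \<in> points f \<Longrightarrow> v \<notin> Q \<Longrightarrow> Q \<in> U \<and> s \<notin> Q \<and> \<sigma> Q = frac f Q a s"
proof -
  obtain V a s d where V: "open_subset f V" "P \<in> V" "V \<subseteq> U" "homogeneous d a" "homogeneous d s"
    "\<forall>Q\<in>V. s \<notin> Q \<and> \<sigma> Q = frac f Q a s"
    using assms by (auto simp: sections_def)
  obtain T where T: "\<forall>g\<in>T. \<exists>d. homogeneous d g" "V = {P \<in> points f. \<not> T \<subseteq> P}"
    using V(1) by (auto simp: open_subset_def)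
  then obtain v where v: "v \<in> T" "v \<notin> P" using V(2) by auto
  then obtain dv where dv: "homogeneous dv v" using T by blast
  show ?thesis
  proof (rule that[OF dv v(2) V(4,5)])
    fix Q assume "Q \<in> points f" "v \<notin> Q"
    then have "Q \<in> V" using v T by auto
    then show "Q \<in> U \<and> s \<notin> Q \<and> \<sigma> Q = frac f Q a s" using V by auto
  qed
qed

lemma sectionsI:
  assumes U: "open_subset f U" and ext: "\<sigma> \<in> extensional U"
    and loc: "\<And>P. P \<in> U \<Longrightarrow> \<exists>V a s d. open_subset f V \<and> P \<in> V \<and> V \<subseteq> U \<and>
      homogeneous d a \<and> homogeneous d s \<and> (\<forall>Q\<in>V. s \<notin> Q \<and> \<sigma> Q = frac f Q a s)"
  shows "\<sigma> \<in> carrier (sections f U)"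
proof -
  have "\<sigma> P \<in> stalk f P" if P: "P \<in> U" for P
  proof -
    obtain V a s d where "P \<in> V" "homogeneous d a" "homogeneous d s" "\<forall>Q\<in>V. s \<notin> Q \<and> \<sigma> Q = frac f Q a s"
      using loc[OF P] by blast
    then show ?thesis
      using frac_in_stalk[OF open_subset_prime[OF U P] fractionsI] by auto
  qed
  then show ?thesis using ext loc by (auto simp: sections_def PiE_iff)
qed

lemma frac_section_in_sections:
  assumes U: "open_subset f U" and as: "homogeneous d a" "homogeneous d s"
    and s: "\<And>P. P \<in> U \<Longrightarrow> s \<notin> P"
  shows "frac_section f U a s \<in> carrier (sections f U)"
proof (rule sectionsI[OF U])
  show "frac_section f U a s \<in> extensional U" by (simp add: frac_section_def)
next
  fix P assume "P \<in> U"
  then show "\<exists>V a' s' d. open_subset f V \<and> P \<in> V \<and> V \<subseteq> U \<and> homogeneous d a' \<and> homogeneous d s' \<and>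
      (\<forall>Q\<in>V. s' \<notin> Q \<and> frac_section f U a s Q = frac f Q a' s')"
    using U as s by (intro exI[of _ U] exI[of _ a] exI[of _ s] exI[of _ d]) (simp add: frac_section_def)
qed

lemma section_mult_apply:
  "P \<in> U \<Longrightarrow> (\<sigma> \<otimes>\<^bsub>sections f U\<^esub> \<tau>) P = stalk_mult f P (\<sigma> P) (\<tau> P)"
  by (simp add: sections_def)

lemma section_add_apply:
  "P \<in> U \<Longrightarrow> (\<sigma> \<oplus>\<^bsub>sections f U\<^esub> \<tau>) P = stalk_add f P (\<sigma> P) (\<tau> P)"
  by (simp add: sections_def)

lemma section_mult_extensional: "\<sigma> \<otimes>\<^bsub>sections f U\<^esub> \<tau> \<in> extensional U"
  by (simp add: sections_def)

lemma section_add_extensional: "\<sigma> \<oplus>\<^bsub>sections f U\<^esub> \<tau> \<in> extensional U"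
  by (simp add: sections_def)

lemma section_square_extensional: "\<sigma> [^]\<^bsub>sections f U\<^esub> (2::nat) \<in> extensional U"
  by (simp add: nat_pow_def numeral_2_eq_2 section_mult_extensional)

lemma section_square_apply:
  assumes "homogeneous_prime P" "P \<in> U" "(a, s) \<in> fractions P" "\<sigma> P = frac f P a s"
  shows "(\<sigma> [^]\<^bsub>sections f U\<^esub> (2::nat)) P = frac f P (a\<^sup>2) (s\<^sup>2)"
proof -
  have one: "(1, 1) \<in> fractions P"
    by (rule fractionsI[of _ _ 0]) (simp_all add: prime_one_notin assms)
  have "(\<sigma> [^]\<^bsub>sections f U\<^esub> (2::nat)) P =
      stalk_mult f P (stalk_mult f P (frac f P 1 1) (frac f P a s)) (frac f P a s)"
    using assms by (simp add: nat_pow_def numeral_2_eq_2 section_mult_apply) (simp add: sections_def)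
  also have "\<dots> = frac f P (a\<^sup>2) (s\<^sup>2)"
    using assms one fractions_mult[OF assms(1) assms(3,3)]
    by (simp add: stalk_mult_frac power2_eq_square)
  finally show ?thesis .
qed

section \<open>Graded splittings of the coordinate ring\<close>

text \<open>A splitting of the Frobenius map of the graded ring \<open>S/f\<close> in characteristic two, as a map on
  representatives in \<open>S\<close>. Degrees are written as \<open>d + d\<close>, the degree of \<open>a s\<close> for a fraction \<open>a/s\<close>.\<close>
locale graded_splitting =
  fixes f :: "('n::finite, 'k::field) mpoly" and \<theta> :: "('n, 'k) mpoly \<Rightarrow> ('n, 'k) mpoly"
  assumes theta_add: "\<theta> (g + h) = \<theta> g + \<theta> h"
    and theta_square_mult: "\<theta> (g\<^sup>2 * h) = g * \<theta> h"
    and theta_one: "\<theta> 1 = 1"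
    and theta_dvd: "f dvd g \<Longrightarrow> f dvd \<theta> g"
    and theta_homogeneous: "homogeneous (d + d) g \<Longrightarrow> homogeneous d (\<theta> g)"
begin

lemma theta_diff: "\<theta> (g - h) = \<theta> g - \<theta> h"
  using theta_add[of "g - h" h] by (simp add: eq_diff_eq)

text \<open>Since \<open>a/s = a s/s\<^sup>2\<close>, linearity over squares leaves no other choice for the induced map on
  stalks.\<close>
definition germ_map :: "('n, 'k) mpoly set \<Rightarrow> ('n, 'k) germ \<Rightarrow> ('n, 'k) germ"
  where "germ_map P x = (\<Union>(a, s)\<in>x. frac f P (\<theta> (a * s)) s)"

lemma theta_fraction:
  assumes "(a, s) \<in> fractions P"
  shows "(\<theta> (a * s), s) \<in> fractions P"
  using assms by (auto elim!: fractionsE intro!: fractionsI theta_homogeneous homogeneous_mult)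

text \<open>If \<open>u\<close> annihilates \<open>a t - b s\<close> modulo \<open>f\<close>, then it annihilates \<open>\<theta> (a s) t - \<theta> (b t) s\<close>, because
  \<open>u\<close> times the latter is the image of \<open>(u t)\<^sup>2 a s - (u s)\<^sup>2 b t\<close>, a multiple of \<open>u (a t - b s)\<close>.\<close>
lemma germ_map_frac:
  assumes P: "homogeneous_prime P" and as: "(a, s) \<in> fractions P"
  shows "germ_map P (frac f P a s) = frac f P (\<theta> (a * s)) s"
  unfolding germ_map_def
proof (rule UN_frac[OF P as])
  fix b t assume "((a, s), (b, t)) \<in> frac_rel f P"
  then obtain u d where "(a, s) \<in> fractions P" and u: "(b, t) \<in> fractions P" "u \<notin> P" "homogeneous d u"
    "f dvd u * (a * t - b * s)" by (rule frac_relE[OF P])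
  have "f dvd \<theta> ((u * s * t) * (u * (a * t - b * s)))"
    by (rule theta_dvd[OF dvd_mult[OF u(4)]])
  also have "(u * s * t) * (u * (a * t - b * s)) = (u * t)\<^sup>2 * (a * s) - (u * s)\<^sup>2 * (b * t)"
    by (simp add: power2_eq_square algebra_simps)
  also have "\<theta> \<dots> = u * (\<theta> (a * s) * t - \<theta> (b * t) * s)"
    unfolding theta_diff theta_square_mult by (simp add: algebra_simps)
  finally have "frac f P (\<theta> (a * s)) s = frac f P (\<theta> (b * t)) t"
    using u by (subst frac_eq_iff[OF P theta_fraction[OF as] theta_fraction[OF u(1)]]) blast
  then show "frac f P (\<theta> (b * t)) t = frac f P (\<theta> (a * s)) s" by simp
qed

lemma frobenius_split:
  assumes char: "CHAR('k) = 2"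
  shows "frobenius_split f"
proof -
  define \<phi> where "\<phi> U \<sigma> = (\<lambda>P\<in>U. germ_map P (\<sigma> P))" for U :: "('n, 'k) mpoly set set" and \<sigma>
  have maps: "\<phi> U \<sigma> \<in> carrier (sections f U)"
    if U: "open_subset f U" and \<sigma>: "\<sigma> \<in> carrier (sections f U)" for U \<sigma>
  proof (rule sectionsI[OF U])
    show "\<phi> U \<sigma> \<in> extensional U" by (simp add: \<phi>_def)
  next
    fix P assume "P \<in> U"
    then obtain V a s d where V: "open_subset f V" "P \<in> V" "V \<subseteq> U" "homogeneous d a" "homogeneous d s"
      "\<forall>Q\<in>V. s \<notin> Q \<and> \<sigma> Q = frac f Q a s"
      using \<sigma> by (auto simp: sections_def)
    have "\<phi> U \<sigma> Q = frac f Q (\<theta> (a * s)) s" if "Q \<in> V" for Q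
    proof -
      have "(a, s) \<in> fractions Q" using V that by (auto intro: fractionsI)
      then show ?thesis using V that open_subset_prime[OF V(1) that] germ_map_frac by (auto simp: \<phi>_def)
    qed
    moreover have "homogeneous d (\<theta> (a * s))" using V by (intro theta_homogeneous homogeneous_mult)
    ultimately show "\<exists>V a s d. open_subset f V \<and> P \<in> V \<and> V \<subseteq> U \<and> homogeneous d a \<and> homogeneous d s \<and>
        (\<forall>Q\<in>V. s \<notin> Q \<and> \<phi> U \<sigma> Q = frac f Q a s)"
      using V by blast
  qed
  have add: "\<phi> U (\<sigma> \<oplus>\<^bsub>sections f U\<^esub> \<tau>) = \<phi> U \<sigma> \<oplus>\<^bsub>sections f U\<^esub> \<phi> U \<tau>"
    if U: "open_subset f U" and \<sigma>: "\<sigma> \<in> carrier (sections f U)" and \<tau>: "\<tau> \<in> carrier (sections f U)"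
    for U \<sigma> \<tau>
  proof (rule extensionalityI[OF _ section_add_extensional])
    show "\<phi> U (\<sigma> \<oplus>\<^bsub>sections f U\<^esub> \<tau>) \<in> extensional U" by (simp add: \<phi>_def)
  next
    fix P assume PU: "P \<in> U"
    note P = open_subset_prime[OF U PU]
    obtain a s where as: "(a, s) \<in> fractions P" "\<sigma> P = frac f P a s" using sections_germ[OF \<sigma> PU U] .
    obtain b t where bt: "(b, t) \<in> fractions P" "\<tau> P = frac f P b t" using sections_germ[OF \<tau> PU U] .
    have eq: "\<theta> ((a * t + b * s) * (s * t)) = \<theta> (a * s) * t + \<theta> (b * t) * s"
    proof -
      have prod: "(a * t + b * s) * (s * t) = t\<^sup>2 * (a * s) + s\<^sup>2 * (b * t)"
        by (simp add: power2_eq_square algebra_simps)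
      show ?thesis unfolding prod theta_add theta_square_mult by (simp only: mult.commute)
    qed
    have "\<phi> U (\<sigma> \<oplus>\<^bsub>sections f U\<^esub> \<tau>) P = germ_map P (frac f P (a * t + b * s) (s * t))"
      using PU as bt by (simp add: \<phi>_def section_add_apply stalk_add_frac[OF P])
    also have "\<dots> = stalk_add f P (frac f P (\<theta> (a * s)) s) (frac f P (\<theta> (b * t)) t)"
      by (simp only: germ_map_frac[OF P fractions_add[OF P as(1) bt(1)]] eq
          stalk_add_frac[OF P theta_fraction[OF as(1)] theta_fraction[OF bt(1)]])
    also have "\<dots> = (\<phi> U \<sigma> \<oplus>\<^bsub>sections f U\<^esub> \<phi> U \<tau>) P"
      using PU as bt by (simp add: \<phi>_def section_add_apply germ_map_frac[OF P])
    finally show "\<phi> U (\<sigma> \<oplus>\<^bsub>sections f U\<^esub> \<tau>) P = (\<phi> U \<sigma> \<oplus>\<^bsub>sections f U\<^esub> \<phi> U \<tau>) P" .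
  qed
  have linear: "\<phi> U ((\<sigma> [^]\<^bsub>sections f U\<^esub> (2::nat)) \<otimes>\<^bsub>sections f U\<^esub> \<tau>) = \<sigma> \<otimes>\<^bsub>sections f U\<^esub> \<phi> U \<tau>"
    if U: "open_subset f U" and \<sigma>: "\<sigma> \<in> carrier (sections f U)" and \<tau>: "\<tau> \<in> carrier (sections f U)"
    for U \<sigma> \<tau>
  proof (rule extensionalityI[OF _ section_mult_extensional])
    show "\<phi> U ((\<sigma> [^]\<^bsub>sections f U\<^esub> (2::nat)) \<otimes>\<^bsub>sections f U\<^esub> \<tau>) \<in> extensional U"
      by (simp add: \<phi>_def)
  next
    fix P assume PU: "P \<in> U"
    note P = open_subset_prime[OF U PU]
    obtain a s where as: "(a, s) \<in> fractions P" "\<sigma> P = frac f P a s" using sections_germ[OF \<sigma> PU U] .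
    obtain b t where bt: "(b, t) \<in> fractions P" "\<tau> P = frac f P b t" using sections_germ[OF \<tau> PU U] .
    have sq: "(a\<^sup>2, s\<^sup>2) \<in> fractions P"
      using fractions_mult[OF P as(1) as(1)] by (simp add: power2_eq_square)
    have eq: "\<theta> ((a\<^sup>2 * b) * (s\<^sup>2 * t)) = a * s * \<theta> (b * t)"
    proof -
      have prod: "(a\<^sup>2 * b) * (s\<^sup>2 * t) = (a * s)\<^sup>2 * (b * t)" by (simp add: power2_eq_square algebra_simps)
      show ?thesis unfolding prod theta_square_mult ..
    qed
    have "\<phi> U ((\<sigma> [^]\<^bsub>sections f U\<^esub> (2::nat)) \<otimes>\<^bsub>sections f U\<^esub> \<tau>) P =
        germ_map P (frac f P (a\<^sup>2 * b) (s\<^sup>2 * t))"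
      using PU bt section_square_apply[of P U a s \<sigma>, OF P PU as]
      by (simp add: \<phi>_def section_mult_apply stalk_mult_frac[OF P sq bt(1)])
    also have "\<dots> = frac f P (a * s * \<theta> (b * t)) (s\<^sup>2 * t)"
      by (simp only: germ_map_frac[OF P fractions_mult[OF P sq bt(1)]] eq)
    also have "\<dots> = frac f P (a * \<theta> (b * t)) (s * t)"
    proof (rule frac_cross_eq[OF P])
      show "(a * s * \<theta> (b * t), s\<^sup>2 * t) \<in> fractions P"
        using theta_fraction[OF fractions_mult[OF P sq bt(1)]] by (simp only: eq)
      show "(a * \<theta> (b * t), s * t) \<in> fractions P"
        by (rule fractions_mult[OF P as(1) theta_fraction[OF bt(1)]])
    qed (simp add: power2_eq_square algebra_simps)
    also have "\<dots> = (\<sigma> \<otimes>\<^bsub>sections f U\<^esub> \<phi> U \<tau>) P"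
      using PU as bt
      by (simp add: \<phi>_def section_mult_apply germ_map_frac[OF P] stalk_mult_frac[OF P as(1) theta_fraction])
    finally show "\<phi> U ((\<sigma> [^]\<^bsub>sections f U\<^esub> (2::nat)) \<otimes>\<^bsub>sections f U\<^esub> \<tau>) P =
        (\<sigma> \<otimes>\<^bsub>sections f U\<^esub> \<phi> U \<tau>) P" .
  qed
  have split: "\<phi> U (\<sigma> [^]\<^bsub>sections f U\<^esub> (2::nat)) = \<sigma>"
    if U: "open_subset f U" and \<sigma>: "\<sigma> \<in> carrier (sections f U)" for U \<sigma>
  proof (rule extensionalityI[OF _ sections_extensional[OF \<sigma>]])
    show "\<phi> U (\<sigma> [^]\<^bsub>sections f U\<^esub> (2::nat)) \<in> extensional U" by (simp add: \<phi>_def)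
  next
    fix P assume PU: "P \<in> U"
    note P = open_subset_prime[OF U PU]
    obtain a s where as: "(a, s) \<in> fractions P" "\<sigma> P = frac f P a s" using sections_germ[OF \<sigma> PU U] .
    have sq: "(a\<^sup>2, s\<^sup>2) \<in> fractions P"
      using fractions_mult[OF P as(1) as(1)] by (simp add: power2_eq_square)
    have eq: "\<theta> (a\<^sup>2 * s\<^sup>2) = a * s"
      using theta_square_mult[of "a * s" 1] by (simp add: power_mult_distrib theta_one)
    have "\<phi> U (\<sigma> [^]\<^bsub>sections f U\<^esub> (2::nat)) P = frac f P (a * s) (s\<^sup>2)"
      using PU section_square_apply[of P U a s \<sigma>, OF P PU as] germ_map_frac[OF P sq]
      by (simp add: \<phi>_def eq)
    also have "\<dots> = frac f P a s"
    proof (rule frac_cross_eq[OF P _ as(1)])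
      show "(a * s, s\<^sup>2) \<in> fractions P" using theta_fraction[OF sq] by (simp only: eq)
    qed (simp add: power2_eq_square algebra_simps)
    finally show "\<phi> U (\<sigma> [^]\<^bsub>sections f U\<^esub> (2::nat)) P = \<sigma> P" by (simp add: as)
  qed
  have restrict: "\<phi> V (restrict \<sigma> V) = restrict (\<phi> U \<sigma>) V" if "V \<subseteq> U" for U V \<sigma>
    using that by (auto simp: \<phi>_def fun_eq_iff restrict_def)
  show ?thesis
    unfolding frobenius_split_def char
    by (rule exI[of _ \<phi>]) (auto simp: maps add linear split restrict)
qed

end

section \<open>The frobenius_trace in characteristic two\<close>

definition sqrt2 :: "'k::alg_closed_field \<Rightarrow> 'k"
  where "sqrt2 c = (SOME y. y\<^sup>2 = c)"

lemma sqrt2_square: "(sqrt2 c)\<^sup>2 = c"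
proof -
  have "\<exists>y. y\<^sup>2 = c" using nth_root_exists[of 2 c] by auto
  then show ?thesis unfolding sqrt2_def by (rule someI_ex)
qed

lemma sqrt2_zero [simp]: "sqrt2 0 = 0"
  using sqrt2_square[of 0] by simp

text \<open>The exponents of the product of all variables with the square of the monomial with exponents
  \<open>m\<close>.\<close>
definition odd_exponents :: "('n::finite \<Rightarrow>\<^sub>0 nat) \<Rightarrow> ('n \<Rightarrow>\<^sub>0 nat)"
  where "odd_exponents m = Abs_poly_mapping (\<lambda>i. 2 * coeff_at m i + 1)"

lemma lookup_odd_exponents [simp]: "coeff_at (odd_exponents m) i = 2 * coeff_at m i + 1"
  by (simp add: odd_exponents_def)

lemma inj_odd_exponents: "inj odd_exponents"
proof (rule injI, rule poly_mapping_eqI)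
  fix m n :: "'a \<Rightarrow>\<^sub>0 nat" and i assume "odd_exponents m = odd_exponents n"
  then have "coeff_at (odd_exponents m) i = coeff_at (odd_exponents n) i" by simp
  then show "coeff_at m i = coeff_at n i" by simp
qed

lemma odd_exponents_add: "odd_exponents (m + n) = (m + m) + odd_exponents n"
  by (rule poly_mapping_eqI) (simp add: lookup_add)

lemma monom_degree_odd_exponents:
  "monom_degree (odd_exponents (m :: 'n::finite \<Rightarrow>\<^sub>0 nat)) = 2 * monom_degree m + CARD('n)"
  unfolding monom_degree_def lookup_odd_exponents sum.distrib by (simp add: sum_distrib_left)

text \<open>The generator of the maps \<open>\<psi>\<close> from \<open>S\<close> to \<open>S\<close> with \<open>\<psi> (a\<^sup>2 g) = a \<psi> g\<close>: it reads off the
  coefficient at the product of all variables in the basis of square-free monomials of \<open>S\<close> over its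
  subring of squares, and takes the square root.\<close>
definition frobenius_trace :: "('n::finite, 'k::alg_closed_field) mpoly \<Rightarrow> ('n, 'k) mpoly"
  where "frobenius_trace g = Abs_poly_mapping (\<lambda>m. sqrt2 (coeff_at g (odd_exponents m)))"

lemma lookup_frobenius_trace: "coeff_at (frobenius_trace g) m = sqrt2 (coeff_at g (odd_exponents m))"
proof -
  have "finite {m. sqrt2 (coeff_at g (odd_exponents m)) \<noteq> 0}"
  proof (rule finite_subset)
    show "{m. sqrt2 (coeff_at g (odd_exponents m)) \<noteq> 0} \<subseteq> odd_exponents -` Poly_Mapping.keys g"
      by (auto simp: in_keys_iff)
    show "finite (odd_exponents -` Poly_Mapping.keys g)"
      by (intro finite_vimageI inj_odd_exponents) simp
  qed
  then show ?thesis by (simp add: frobenius_trace_def)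
qed

lemma frobenius_trace_homogeneous:
  fixes g :: "('n::finite, 'k::alg_closed_field) mpoly"
  assumes "homogeneous (CARD('n) + (d + d)) g"
  shows "homogeneous d (frobenius_trace g)"
proof (rule homogeneousI)
  fix m assume "coeff_at (frobenius_trace g) m \<noteq> 0"
  then have "coeff_at g (odd_exponents m) \<noteq> 0" by (auto simp: lookup_frobenius_trace)
  then have "monom_degree (odd_exponents m) = CARD('n) + (d + d)" using assms homogeneousD by blast
  then show "monom_degree m = d" by (simp add: monom_degree_odd_exponents)
qed

context
  assumes char: "CHAR('k::alg_closed_field) = 2"
begin

lemma double_eq_0: "(x::'k) + x = 0"
proof -
  have "(2::'k) = 0" using of_nat_CHAR[where 'a='k] by (simp add: char)
  then show ?thesis by (simp flip: mult_2)
qed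

lemma sqrt2_unique:
  assumes "(y::'k)\<^sup>2 = c"
  shows "sqrt2 c = y"
proof -
  let ?z = "sqrt2 c"
  have "(?z - y)\<^sup>2 = ?z\<^sup>2 + y\<^sup>2 - (?z * y + ?z * y)" by (simp add: power2_eq_square algebra_simps)
  also have "\<dots> = c + c" by (simp add: sqrt2_square assms double_eq_0)
  finally show ?thesis by (simp add: double_eq_0)
qed

lemma sqrt2_add: "sqrt2 (a + b) = sqrt2 a + sqrt2 (b::'k)"
proof (rule sqrt2_unique)
  have "(sqrt2 a + sqrt2 b)\<^sup>2 = (sqrt2 a)\<^sup>2 + (sqrt2 b)\<^sup>2 + (sqrt2 a * sqrt2 b + sqrt2 a * sqrt2 b)"
    by (simp add: power2_eq_square algebra_simps)
  then show "(sqrt2 a + sqrt2 b)\<^sup>2 = a + b" by (simp add: sqrt2_square double_eq_0)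
qed

lemma sqrt2_square_mult: "sqrt2 (c\<^sup>2 * b) = c * sqrt2 (b::'k)"
  by (rule sqrt2_unique) (simp add: power_mult_distrib sqrt2_square)

lemma frobenius_trace_add: "frobenius_trace (g + h) = frobenius_trace g + frobenius_trace (h :: ('n::finite, 'k) mpoly)"
  by (rule poly_mapping_eqI) (simp add: lookup_frobenius_trace lookup_add sqrt2_add)

lemma mpoly_square_add: "(g + h)\<^sup>2 = g\<^sup>2 + (h :: ('n, 'k) mpoly)\<^sup>2"
proof -
  have "g * h + g * h = 0" by (rule poly_mapping_eqI) (simp only: lookup_add double_eq_0 lookup_zero)
  moreover have "(g + h)\<^sup>2 = g\<^sup>2 + h\<^sup>2 + (g * h + g * h)"
    by (simp add: power2_eq_square algebra_simps)
  ultimately show ?thesis by simp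
qed

lemma frobenius_trace_square_monomial_mult:
  fixes g :: "('n::finite, 'k) mpoly"
  shows "frobenius_trace ((Poly_Mapping.single m c)\<^sup>2 * g) = Poly_Mapping.single m c * frobenius_trace g"
proof (rule poly_mapping_eqI)
  fix n
  have sq: "(Poly_Mapping.single m c)\<^sup>2 = Poly_Mapping.single (m + m) (c\<^sup>2)"
    by (simp add: power2_eq_square mult_single)
  show "coeff_at (frobenius_trace ((Poly_Mapping.single m c)\<^sup>2 * g)) n = coeff_at (Poly_Mapping.single m c * frobenius_trace g) n"
  proof (cases "\<exists>l. n = m + l")
    case True
    then obtain l where n: "n = m + l" by blast
    show ?thesis
      unfolding n lookup_frobenius_trace sq odd_exponents_add lookup_single_mult by (rule sqrt2_square_mult)
  next
    case False
    have "odd_exponents n \<noteq> (m + m) + l" for l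
    proof
      assume eq: "odd_exponents n = (m + m) + l"
      have "coeff_at m i \<le> coeff_at n i" for i
      proof -
        have "coeff_at (odd_exponents n) i = coeff_at ((m + m) + l) i" by (simp add: eq)
        then have "2 * coeff_at n i + 1 = 2 * coeff_at m i + coeff_at l i" by (simp add: lookup_add)
        then show ?thesis by linarith
      qed
      then have "n = m + (n - m)" by (intro poly_mapping_eqI) (simp add: lookup_add lookup_minus)
      with False show False by blast
    qed
    then show ?thesis using False
      by (simp add: lookup_frobenius_trace sq lookup_single_mult_eq_0)
  qed
qed

lemma frobenius_trace_square_mult: "frobenius_trace (a\<^sup>2 * g) = a * frobenius_trace (g :: ('n::finite, 'k) mpoly)"
proof -
  have "frobenius_trace ((\<Sum>m\<in>A. Poly_Mapping.single m (coeff_at a m))\<^sup>2 * g) =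
      (\<Sum>m\<in>A. Poly_Mapping.single m (coeff_at a m)) * frobenius_trace g" if "finite A" for A
    using that
  proof (induction A rule: finite_induct)
    case empty
    show ?case by (rule poly_mapping_eqI) (simp add: lookup_frobenius_trace)
  next
    case (insert m A)
    then show ?case
      by (simp add: mpoly_square_add distrib_right frobenius_trace_add frobenius_trace_square_monomial_mult)
  qed
  from this[OF finite_keys[of a]] show ?thesis by (simp flip: sum_monomials)
qed

text \<open>The sufficient half of Fedder's criterion. The map \<open>g \<mapsto> frobenius_trace (f h g)\<close> preserves the
  multiples of \<open>f\<close> because \<open>f\<^sup>2\<close> comes out of the trace as \<open>f\<close>.\<close>
theorem frobenius_split_of_frobenius_trace:
  fixes f h :: "('n::finite, 'k) mpoly"
  assumes fh: "homogeneous CARD('n) (f * h)" and one: "frobenius_trace (f * h) = 1"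
  shows "frobenius_split f"
proof -
  interpret graded_splitting f "\<lambda>g. frobenius_trace (f * h * g)"
  proof
    show "frobenius_trace (f * h * (a + b)) = frobenius_trace (f * h * a) + frobenius_trace (f * h * b)" for a b
      by (simp add: distrib_left frobenius_trace_add)
    show "frobenius_trace (f * h * (a\<^sup>2 * b)) = a * frobenius_trace (f * h * b)" for a b
      using frobenius_trace_square_mult[of a "f * h * b"] by (simp add: mult_ac)
    show "frobenius_trace (f * h * 1) = 1" by (simp add: one)
    show "f dvd frobenius_trace (f * h * g)" if dvd: "f dvd g" for g
    proof -
      obtain r where "g = f * r" using dvd by (rule dvdE)
      then have "f * h * g = f\<^sup>2 * (h * r)" by (simp add: power2_eq_square mult_ac)
      then show ?thesis by (simp add: frobenius_trace_square_mult)
    qed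
    show "homogeneous d (frobenius_trace (f * h * g))" if "homogeneous (d + d) g" for d g
      by (rule frobenius_trace_homogeneous, rule homogeneous_mult[OF fh that])
  qed
  show ?thesis by (rule frobenius_split[OF char])
qed

end

section \<open>Splittings of the structure sheaf\<close>

lemma frac_section_mult:
  assumes U: "open_subset f U" and "\<And>P. P \<in> U \<Longrightarrow> (a, s) \<in> fractions P"
    "\<And>P. P \<in> U \<Longrightarrow> (b, t) \<in> fractions P"
  shows "frac_section f U a s \<otimes>\<^bsub>sections f U\<^esub> frac_section f U b t = frac_section f U (a * b) (s * t)"
proof (rule extensionalityI[OF section_mult_extensional])
  fix P assume "P \<in> U"
  with assms open_subset_prime[OF U this] show
    "(frac_section f U a s \<otimes>\<^bsub>sections f U\<^esub> frac_section f U b t) P = frac_section f U (a * b) (s * t) P"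
    by (simp add: section_mult_apply frac_section_def stalk_mult_frac)
qed (simp add: frac_section_def)

lemma frac_section_add:
  assumes U: "open_subset f U" and "\<And>P. P \<in> U \<Longrightarrow> (a, s) \<in> fractions P"
    "\<And>P. P \<in> U \<Longrightarrow> (b, t) \<in> fractions P"
  shows "frac_section f U a s \<oplus>\<^bsub>sections f U\<^esub> frac_section f U b t =
    frac_section f U (a * t + b * s) (s * t)"
proof (rule extensionalityI[OF section_add_extensional])
  fix P assume "P \<in> U"
  with assms open_subset_prime[OF U this] show
    "(frac_section f U a s \<oplus>\<^bsub>sections f U\<^esub> frac_section f U b t) P =
      frac_section f U (a * t + b * s) (s * t) P"
    by (simp add: section_add_apply frac_section_def stalk_add_frac)
qed (simp add: frac_section_def)

lemma frac_section_square:
  assumes U: "open_subset f U" and "\<And>P. P \<in> U \<Longrightarrow> (a, s) \<in> fractions P"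
  shows "frac_section f U a s [^]\<^bsub>sections f U\<^esub> (2::nat) = frac_section f U (a\<^sup>2) (s\<^sup>2)"
proof (rule extensionalityI[OF section_square_extensional])
  fix P assume P: "P \<in> U"
  show "(frac_section f U a s [^]\<^bsub>sections f U\<^esub> (2::nat)) P = frac_section f U (a\<^sup>2) (s\<^sup>2) P"
    using section_square_apply[of P U a s "frac_section f U a s" f] open_subset_prime[OF U P] assms P
    by (simp add: frac_section_def)
qed (simp add: frac_section_def)

lemma frac_section_cong:
  assumes U: "open_subset f U" and "\<And>P. P \<in> U \<Longrightarrow> (a, s) \<in> fractions P"
    "\<And>P. P \<in> U \<Longrightarrow> (b, t) \<in> fractions P" and f: "homogeneous df f" "f dvd a * t - b * s"
  shows "frac_section f U a s = frac_section f U b t"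
proof (rule extensionalityI)
  fix P assume P: "P \<in> U"
  note pP = open_subset_prime[OF U P]
  show "frac_section f U a s P = frac_section f U b t P"
    using frac_eqI[OF pP f(1), of a s b t 1] prime_one_notin[OF pP] assms P
    by (simp add: frac_section_def)
qed (simp_all add: frac_section_def)

lemma frac_section_apply: "P \<in> U \<Longrightarrow> frac_section f U a s P = frac f P a s"
  by (simp add: frac_section_def)

lemma restrict_frac_section: "V \<subseteq> U \<Longrightarrow> restrict (frac_section f U a s) V = frac_section f V a s"
  by (auto simp: frac_section_def restrict_def fun_eq_iff)

lemma basic_openD: "P \<in> basic_open f v \<Longrightarrow> P \<in> points f \<and> v \<notin> P \<and> homogeneous_prime P"
  by (auto simp: basic_open_def dest: pointsD)

lemma open_basic_open_X [simp]: "open_subset f (basic_open f (X i))"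
  by (rule open_basic_open[OF homogeneous_X])

lemma fractions_X_power:
  "P \<in> basic_open f (X j) \<Longrightarrow> homogeneous d a \<Longrightarrow> (a, X j ^ d) \<in> fractions P"
  by (intro fractionsI[of _ _ d]) (auto dest: basic_openD prime_power_notin)

text \<open>A splitting \<open>\<phi>\<close> of the structure sheaf on a hypersurface of degree at least three in at least
  three variables, from which a map \<open>theta\<close> from quadratic to linear forms is constructed.\<close>
locale sheaf_splitting =
  fixes f :: "('n::{finite,linorder}, 'k::field) mpoly"
    and \<phi> :: "('n, 'k) mpoly set set \<Rightarrow> (('n, 'k) mpoly set \<Rightarrow> ('n, 'k) germ) \<Rightarrow>
      (('n, 'k) mpoly set \<Rightarrow> ('n, 'k) germ)"
    and i1 i2 i3 :: 'n and df :: nat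
  assumes phi_maps: "open_subset f U \<Longrightarrow> \<sigma> \<in> carrier (sections f U) \<Longrightarrow> \<phi> U \<sigma> \<in> carrier (sections f U)"
    and phi_add: "open_subset f U \<Longrightarrow> \<sigma> \<in> carrier (sections f U) \<Longrightarrow> \<tau> \<in> carrier (sections f U) \<Longrightarrow>
      \<phi> U (\<sigma> \<oplus>\<^bsub>sections f U\<^esub> \<tau>) = \<phi> U \<sigma> \<oplus>\<^bsub>sections f U\<^esub> \<phi> U \<tau>"
    and phi_square_mult: "open_subset f U \<Longrightarrow> \<sigma> \<in> carrier (sections f U) \<Longrightarrow> \<tau> \<in> carrier (sections f U) \<Longrightarrow>
      \<phi> U ((\<sigma> [^]\<^bsub>sections f U\<^esub> (2::nat)) \<otimes>\<^bsub>sections f U\<^esub> \<tau>) = \<sigma> \<otimes>\<^bsub>sections f U\<^esub> \<phi> U \<tau>"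
    and phi_square: "open_subset f U \<Longrightarrow> \<sigma> \<in> carrier (sections f U) \<Longrightarrow>
      \<phi> U (\<sigma> [^]\<^bsub>sections f U\<^esub> (2::nat)) = \<sigma>"
    and phi_restrict: "open_subset f U \<Longrightarrow> open_subset f V \<Longrightarrow> V \<subseteq> U \<Longrightarrow> \<sigma> \<in> carrier (sections f U) \<Longrightarrow>
      \<phi> V (restrict \<sigma> V) = restrict (\<phi> U \<sigma>) V"
    and distinct_variables: "i1 \<noteq> i2" "i3 \<noteq> i1" "i3 \<noteq> i2"
    and f: "homogeneous df f" "f \<noteq> 0" "2 < df"
begin

abbreviation chart :: "'n \<Rightarrow> ('n, 'k) mpoly set set"
  where "chart j \<equiv> basic_open f (X j)"

text \<open>The section \<open>\<phi> (q/x\<^sub>j\<^sup>2)\<close> over the chart where \<open>x\<^sub>j\<close> is invertible; \<open>x\<^sub>j\<close> times it is the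
  restriction of a section of \<open>O(1)\<close>.\<close>
definition chart_value :: "('n, 'k) mpoly \<Rightarrow> 'n \<Rightarrow> ('n, 'k) mpoly set \<Rightarrow> ('n, 'k) germ"
  where "chart_value q j = \<phi> (chart j) (frac_section f (chart j) q (X j ^ 2))"

lemma frac_section_chart:
  assumes "homogeneous d a"
  shows "frac_section f (chart j) a (X j ^ d) \<in> carrier (sections f (chart j))"
  using assms by (intro frac_section_in_sections[of _ _ d])
    (auto dest: basic_openD prime_power_notin)

lemma chart_value_in_sections:
  "homogeneous 2 q \<Longrightarrow> chart_value q j \<in> carrier (sections f (chart j))"
  unfolding chart_value_def by (intro phi_maps frac_section_chart) simp_all

text \<open>On the overlap \<open>q/x\<^sub>j\<^sup>2 = (x\<^sub>i/x\<^sub>j)\<^sup>2 (q/x\<^sub>i\<^sup>2)\<close>, and \<open>\<phi>\<close> takes the square out as \<open>x\<^sub>i/x\<^sub>j\<close>. So the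
  products \<open>x\<^sub>j \<phi> (q/x\<^sub>j\<^sup>2)\<close> glue.\<close>
lemma chart_value_change_chart:
  assumes q: "homogeneous 2 q" and Q: "Q \<in> chart i" "Q \<in> chart j"
  shows "chart_value q j Q = stalk_mult f Q (frac f Q (X i) (X j)) (chart_value q i Q)"
proof -
  define V where "V = basic_open f (X i * X j)"
  have V: "open_subset f V"
    unfolding V_def by (rule open_basic_open[OF homogeneous_mult[OF homogeneous_X homogeneous_X]])
  have sub: "V \<subseteq> chart i" "V \<subseteq> chart j"
    using ideal_mult ideal_mult' prime_homogeneous_ideal pointsD(1) by (fastforce simp: V_def basic_open_def)+
  have QV: "Q \<in> V"
    using Q prime_mult_notin pointsD(1) by (fastforce simp: V_def basic_open_def)
  have chart_value_V: "chart_value q m Q = \<phi> V (frac_section f V q (X m ^ 2)) Q" if "V \<subseteq> chart m" for m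
  proof -
    have "chart_value q m Q = restrict (chart_value q m) V Q" using QV by simp
    also have "\<dots> = \<phi> V (frac_section f V q (X m ^ 2)) Q"
      unfolding chart_value_def
      by (subst phi_restrict[OF _ V that frac_section_chart[OF q], symmetric])
        (simp_all add: restrict_frac_section[OF that])
    finally show ?thesis .
  qed
  have frac: "\<And>P. P \<in> V \<Longrightarrow> (q, X i ^ 2) \<in> fractions P" "\<And>P. P \<in> V \<Longrightarrow> (q, X j ^ 2) \<in> fractions P"
    using sub q by (auto intro: fractions_X_power)
  have frac': "\<And>P. P \<in> V \<Longrightarrow> (X i, X j) \<in> fractions P"
    using sub fractions_X_power[of _ f j 1 "X i"] by auto
  then have frac'': "\<And>P. P \<in> V \<Longrightarrow> ((X i)\<^sup>2, (X j)\<^sup>2) \<in> fractions P"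
    using fractions_mult[OF open_subset_prime[OF V]] by (simp add: power2_eq_square)
  have sec: "frac_section f V (X i) (X j) \<in> carrier (sections f V)"
    using frac' by (intro frac_section_in_sections[OF V homogeneous_X homogeneous_X]) (auto elim: fractionsE)
  have sec': "frac_section f V q (X i ^ 2) \<in> carrier (sections f V)"
    using frac by (intro frac_section_in_sections[OF V q homogeneous_X_power]) (auto elim: fractionsE)
  have "frac_section f V q (X j ^ 2) = frac_section f V ((X i)\<^sup>2 * q) ((X j)\<^sup>2 * (X i)\<^sup>2)"
    using frac frac'' open_subset_prime[OF V]
    by (intro frac_section_cong[OF V _ _ f(1)] fractions_mult) (auto simp: mult_ac)
  also have "\<dots> = (frac_section f V (X i) (X j) [^]\<^bsub>sections f V\<^esub> (2::nat)) \<otimes>\<^bsub>sections f V\<^esub>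
      frac_section f V q (X i ^ 2)"
    using frac frac' frac'' by (simp add: frac_section_square[OF V] frac_section_mult[OF V])
  finally have "chart_value q j Q = (frac_section f V (X i) (X j) \<otimes>\<^bsub>sections f V\<^esub>
      \<phi> V (frac_section f V q (X i ^ 2))) Q"
    by (simp add: chart_value_V[OF sub(2)] phi_square_mult[OF V sec sec'])
  then show ?thesis
    using QV by (simp add: section_mult_apply frac_section_apply chart_value_V[OF sub(1)])
qed

lemma chart_value_linear_form:
  assumes q: "homogeneous 2 q"
  shows "\<exists>l. homogeneous 1 l \<and> (\<forall>j. \<forall>Q\<in>chart j. chart_value q j Q = frac f Q l (X j))"
proof -
  have "\<exists>j a t. Q \<in> chart j \<and> (a, t) \<in> fractions Q \<and> chart_value q j Q = frac f Q a t"
    if Q: "Q \<in> points f" for Q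
  proof -
    obtain j where j: "Q \<in> chart j" using pointsD(3)[OF Q] Q by (auto simp: basic_open_def)
    then show ?thesis using sections_germ[OF chart_value_in_sections[OF q] j open_basic_open_X] by metis
  qed
  then obtain j a t where jat: "\<And>Q. Q \<in> points f \<Longrightarrow> Q \<in> chart (j Q)"
    "\<And>Q. Q \<in> points f \<Longrightarrow> (a Q, t Q) \<in> fractions Q"
    "\<And>Q. Q \<in> points f \<Longrightarrow> chart_value q (j Q) Q = frac f Q (a Q) (t Q)"
    by metis
  have X_fractions: "(X i, X m) \<in> fractions Q" if "Q \<in> chart m" for i m Q
    using fractions_X_power[OF that homogeneous_X] by simp
  have "\<exists>l. homogeneous 1 l \<and> (\<forall>Q\<in>points f. \<exists>u. u \<notin> Q \<and> f dvd u * (X (j Q) * a Q - l * t Q))"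
  proof (rule twisted_global_sections[OF distinct_variables f(1,2)])
    show "t P \<notin> P" if "P \<in> points f" for P using jat(2)[OF that] by (auto elim: fractionsE)
  next
    fix P assume P: "P \<in> points f"
    obtain v dv b s d where v: "homogeneous dv v" "v \<notin> P" "homogeneous d b" "homogeneous d s"
      and vQ: "\<And>Q. Q \<in> points f \<Longrightarrow> v \<notin> Q \<Longrightarrow>
        Q \<in> chart (j P) \<and> s \<notin> Q \<and> chart_value q (j P) Q = frac f Q b s"
      using sections_locally_fraction[OF chart_value_in_sections[OF q] jat(1)[OF P]] by metis
    have "s \<notin> Q \<and> (\<exists>u. u \<notin> Q \<and> f dvd u * (X (j Q) * a Q * s - b * X (j P) * t Q))"
      if Q: "Q \<in> points f" "v \<notin> Q" for Q
    proof -
      note pQ = pointsD(1)[OF Q(1)] and Q' = vQ[OF Q]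
      have bs: "(b, s) \<in> fractions Q" using v Q' by (auto intro: fractionsI)
      note X = X_fractions[OF jat(1)[OF Q(1)], of "j P"]
      have "frac f Q (a Q) (t Q) = stalk_mult f Q (frac f Q (X (j P)) (X (j Q))) (frac f Q b s)"
        using chart_value_change_chart[OF q, of Q "j P" "j Q"] Q' jat Q by simp
      also have "\<dots> = frac f Q (X (j P) * b) (X (j Q) * s)"
        by (rule stalk_mult_frac[OF pQ X bs])
      finally obtain u where "u \<notin> Q" "f dvd u * (a Q * (X (j Q) * s) - X (j P) * b * t Q)"
        using frac_eq_iff[OF pQ jat(2)[OF Q(1)] fractions_mult[OF pQ X bs]] by blast
      then show ?thesis using Q' by (auto simp: mult_ac)
    qed
    moreover have "homogeneous (d + 1) (b * X (j P))" using homogeneous_mult[OF v(3) homogeneous_X] by simp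
    ultimately show "\<exists>v dv b s d. homogeneous dv v \<and> v \<notin> P \<and> homogeneous (d + 1) b \<and> homogeneous d s \<and>
      (\<forall>Q\<in>points f. v \<notin> Q \<longrightarrow> s \<notin> Q \<and> (\<exists>u. u \<notin> Q \<and> f dvd u * (X (j Q) * a Q * s - b * t Q)))"
      using v by blast
  qed
  then obtain l where l: "homogeneous 1 l"
    "\<And>Q. Q \<in> points f \<Longrightarrow> \<exists>u. u \<notin> Q \<and> f dvd u * (X (j Q) * a Q - l * t Q)" by blast
  have "chart_value q m Q = frac f Q l (X m)" if m: "Q \<in> chart m" for m Q
  proof -
    have Q: "Q \<in> points f" "homogeneous_prime Q" using basic_openD[OF m] by auto
    note X = X_fractions[OF m, of "j Q"]
    have lX: "(l, X i) \<in> fractions Q" if "Q \<in> chart i" for i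
      using fractions_X_power[OF that l(1)] by simp
    obtain u where u: "u \<notin> Q" "f dvd u * (X (j Q) * a Q - l * t Q)" using l(2)[OF Q(1)] by blast
    have "chart_value q (j Q) Q = frac f Q l (X (j Q))"
      unfolding jat(3)[OF Q(1)]
      by (rule frac_eqI[OF Q(2) f(1) jat(2)[OF Q(1)] lX[OF jat(1)[OF Q(1)]] u(1)])
        (use u in \<open>simp add: mult.commute\<close>)
    then have "chart_value q m Q = frac f Q (X (j Q) * l) (X m * X (j Q))"
      using chart_value_change_chart[OF q jat(1)[OF Q(1)] m] stalk_mult_frac[OF Q(2) X lX[OF jat(1)[OF Q(1)]]]
      by simp
    also have "\<dots> = frac f Q l (X m)"
      by (rule frac_cross_eq[OF Q(2) fractions_mult[OF Q(2) X lX[OF jat(1)[OF Q(1)]]] lX[OF m]])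
        (simp add: mult_ac)
    finally show ?thesis .
  qed
  then show ?thesis using l by blast
qed

definition theta :: "('n, 'k) mpoly \<Rightarrow> ('n, 'k) mpoly"
  where "theta q = (SOME l. homogeneous 1 l \<and> (\<forall>j. \<forall>Q\<in>chart j. chart_value q j Q = frac f Q l (X j)))"

lemma theta_linear: "homogeneous 2 q \<Longrightarrow> homogeneous 1 (theta q)"
  and chart_value_theta: "homogeneous 2 q \<Longrightarrow> Q \<in> chart j \<Longrightarrow> chart_value q j Q = frac f Q (theta q) (X j)"
  using someI_ex[OF chart_value_linear_form, of q] unfolding theta_def by blast+

text \<open>A form that is zero in all stalks is a multiple of \<open>f\<close>. So identities between forms of degree
  less than that of \<open>f\<close> can be checked on germs.\<close>
lemma small_form_eq_0:
  assumes g: "homogeneous e g" "e < df"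
    and zero: "\<And>Q j. Q \<in> chart j \<Longrightarrow> frac f Q g (X j ^ e) = frac f Q 0 (X j ^ e)"
  shows "g = 0"
proof -
  have "f dvd g"
  proof (rule vanishing_form[OF distinct_variables(1) f(1,2) g(1)])
    fix Q assume Q: "Q \<in> points f"
    then obtain j where j: "Q \<in> chart j" using pointsD(3)[OF Q] by (auto simp: basic_open_def)
    note pQ = pointsD(1)[OF Q]
    obtain u where "u \<notin> Q" "f dvd u * (g * X j ^ e - 0 * X j ^ e)"
      using zero[OF j] frac_eq_iff[OF pQ fractions_X_power[OF j g(1)] fractions_X_power[OF j homogeneous_zero]]
      by blast
    moreover have "X j ^ e \<notin> Q" using basic_openD[OF j] by (auto dest: prime_power_notin)
    ultimately show "\<exists>u. u \<notin> Q \<and> f dvd u * g"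
      using prime_mult_notin[OF pQ, of u "X j ^ e"] by (intro exI[of _ "u * X j ^ e"]) (simp add: mult_ac)
  qed
  then show ?thesis using homogeneous_dvd_smaller_degree[OF f(1) _ g] by blast
qed

lemma theta_square:
  assumes l: "homogeneous 1 l"
  shows "theta (l\<^sup>2) = l"
proof -
  have l2: "homogeneous 2 (l\<^sup>2)" using homogeneous_power[OF l, of 2] by simp
  have "theta (l\<^sup>2) - l = 0"
  proof (rule small_form_eq_0)
    show "homogeneous 1 (theta (l\<^sup>2) - l)" by (rule homogeneous_diff[OF theta_linear[OF l2] l])
    show "1 < df" using f by simp
    fix Q j assume Q: "Q \<in> chart j"
    note pQ = basic_openD[OF Q, THEN conjunct2, THEN conjunct2]
    have lX: "(l, X j) \<in> fractions P" if "P \<in> chart j" for P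
      using fractions_X_power[OF that l] by simp
    have tX: "(theta (l\<^sup>2), X j) \<in> fractions Q"
      using fractions_X_power[OF Q theta_linear[OF l2]] by simp
    have sec: "frac_section f (chart j) l (X j) \<in> carrier (sections f (chart j))"
      using frac_section_chart[OF l, of j] by simp
    have "chart_value (l\<^sup>2) j = frac_section f (chart j) l (X j)"
      unfolding chart_value_def
      by (subst frac_section_square[OF open_basic_open_X lX, symmetric])
        (simp_all add: phi_square[OF open_basic_open_X sec])
    then have "frac f Q (theta (l\<^sup>2)) (X j) = frac f Q l (X j)"
      using chart_value_theta[OF l2 Q] Q by (simp add: frac_section_apply)
    then obtain u where u: "u \<notin> Q" "f dvd u * (theta (l\<^sup>2) * X j - l * X j)"
      using frac_eq_iff[OF pQ tX lX[OF Q]] by blast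
    show "frac f Q (theta (l\<^sup>2) - l) (X j ^ 1) = frac f Q 0 (X j ^ 1)"
    proof (rule frac_eqI[OF pQ f(1) _ _ u(1)])
      show "(theta (l\<^sup>2) - l, X j ^ 1) \<in> fractions Q"
        by (rule fractions_X_power[OF Q homogeneous_diff[OF theta_linear[OF l2] l]])
      show "(0, X j ^ 1) \<in> fractions Q" by (rule fractions_X_power[OF Q homogeneous_zero])
    qed (use u in \<open>simp add: left_diff_distrib\<close>)
  qed
  then show ?thesis by simp
qed

text \<open>Linearity over squares with \<open>0 = 0\<^sup>2 0\<close> shows that \<open>\<phi>\<close> preserves zero, so cancellation in the
  stalks is avoided.\<close>
lemma phi_zero:
  assumes Q: "Q \<in> chart j"
  shows "\<phi> (chart j) (frac_section f (chart j) 0 (X j ^ d)) Q = frac f Q 0 (X j ^ e)"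
proof -
  note U = open_basic_open_X[of f j] and pQ = basic_openD[OF Q, THEN conjunct2, THEN conjunct2]
  let ?z = "frac_section f (chart j) 0 (X j ^ d)"
  have z: "?z \<in> carrier (sections f (chart j))" by (rule frac_section_chart[OF homogeneous_zero])
  have fr: "(0, X j ^ d) \<in> fractions P" if "P \<in> chart j" for P d
    by (rule fractions_X_power[OF that homogeneous_zero])
  have fr2: "(0\<^sup>2, (X j ^ d)\<^sup>2) \<in> fractions P" if "P \<in> chart j" for P d
    using fr[OF that, of "d * 2"] by (simp add: power_mult)
  obtain b t where bt: "(b, t) \<in> fractions Q" "\<phi> (chart j) ?z Q = frac f Q b t"
    using sections_germ[OF phi_maps[OF U z] Q U] .
  have "?z = (?z [^]\<^bsub>sections f (chart j)\<^esub> (2::nat)) \<otimes>\<^bsub>sections f (chart j)\<^esub> ?z"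
  proof -
    have sq: "?z [^]\<^bsub>sections f (chart j)\<^esub> (2::nat) = frac_section f (chart j) (0\<^sup>2) ((X j ^ d)\<^sup>2)"
      by (rule frac_section_square[OF U fr])
    have "frac_section f (chart j) (0\<^sup>2) ((X j ^ d)\<^sup>2) \<otimes>\<^bsub>sections f (chart j)\<^esub> ?z =
        frac_section f (chart j) (0\<^sup>2 * 0) ((X j ^ d)\<^sup>2 * X j ^ d)"
      by (rule frac_section_mult[OF U fr2 fr])
    also have "\<dots> = ?z"
      by (rule frac_section_cong[OF U fractions_mult[OF open_subset_prime[OF U] fr2 fr] fr f(1)]) simp_all
    finally show ?thesis unfolding sq by simp
  qed
  then have "\<phi> (chart j) ?z = ?z \<otimes>\<^bsub>sections f (chart j)\<^esub> \<phi> (chart j) ?z"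
    using phi_square_mult[OF U z z] by simp
  then have "\<phi> (chart j) ?z Q = stalk_mult f Q (frac f Q 0 (X j ^ d)) (frac f Q b t)"
    using Q bt by (metis section_mult_apply frac_section_apply)
  also have "\<dots> = frac f Q (0 * b) (X j ^ d * t)" by (rule stalk_mult_frac[OF pQ fr[OF Q] bt(1)])
  also have "\<dots> = frac f Q 0 (X j ^ e)"
    by (rule frac_cross_eq[OF pQ fractions_mult[OF pQ fr[OF Q] bt(1)] fr[OF Q]]) simp
  finally show ?thesis .
qed

text \<open>Over a chart \<open>\<phi> (x\<^sub>i\<^sup>2 q\<^sub>i/x\<^sub>j\<^sup>4) = (x\<^sub>i/x\<^sub>j) \<phi> (q\<^sub>i/x\<^sub>j\<^sup>2) = x\<^sub>i \<theta> (q\<^sub>i)/x\<^sub>j\<^sup>2\<close>; the sum is taken with the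
  additivity of \<open>\<phi>\<close>.\<close>
lemma phi_sum_squares:
  assumes q: "\<And>i. homogeneous 2 (q i)" and Q: "Q \<in> chart j" and A: "finite A"
  shows "\<phi> (chart j) (frac_section f (chart j) (\<Sum>i\<in>A. (X i)\<^sup>2 * q i) (X j ^ 4)) Q =
    frac f Q (\<Sum>i\<in>A. X i * theta (q i)) (X j ^ 2)"
  using A
proof (induction A rule: finite_induct)
  case empty
  then show ?case using phi_zero[OF Q] by simp
next
  case (insert i A)
  let ?U = "chart j" and ?S = "\<Sum>i\<in>A. (X i)\<^sup>2 * q i" and ?T = "\<Sum>i\<in>A. X i * theta (q i)"
  note U = open_basic_open_X[of f j] and pQ = basic_openD[OF Q, THEN conjunct2, THEN conjunct2]
  let ?x = "frac_section f ?U (X i) (X j)" and ?q = "frac_section f ?U (q i) ((X j)\<^sup>2)"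
    and ?s = "frac_section f ?U ?S (X j ^ 4)"
  have x: "?x \<in> carrier (sections f ?U)" using frac_section_chart[OF homogeneous_X, of j i] by simp
  have qs: "?q \<in> carrier (sections f ?U)" by (rule frac_section_chart[OF q])
  have hx: "homogeneous 4 ((X i)\<^sup>2 * q i)" for i
    using homogeneous_mult[OF homogeneous_X_power[of 2 i] q[of i]] by simp
  have hS: "homogeneous 4 ?S" by (rule homogeneous_sum[OF hx])
  have hxt: "homogeneous 2 (X i * theta (q i))" for i
    using homogeneous_mult[OF homogeneous_X theta_linear[OF q]] by (simp add: numeral_2_eq_2)
  have hT: "homogeneous 2 ?T" by (rule homogeneous_sum[OF hxt])
  have s: "?s \<in> carrier (sections f ?U)" by (rule frac_section_chart[OF hS])
  have fx: "(X i, X j) \<in> fractions P" if "P \<in> ?U" for P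
    using fractions_X_power[OF that homogeneous_X] by simp
  have fx2: "((X i)\<^sup>2, (X j)\<^sup>2) \<in> fractions P" if "P \<in> ?U" for P
    by (rule fractions_X_power[OF that homogeneous_X_power])
  have fq: "(q i, (X j)\<^sup>2) \<in> fractions P" if "P \<in> ?U" for P
    by (rule fractions_X_power[OF that q])
  have fS: "(?S, X j ^ 4) \<in> fractions P" if "P \<in> ?U" for P
    by (rule fractions_X_power[OF that hS])
  have ft: "(theta (q i), X j) \<in> fractions Q"
    using fractions_X_power[OF Q theta_linear[OF q]] by simp
  have fT: "(?T, (X j)\<^sup>2) \<in> fractions Q" by (rule fractions_X_power[OF Q hT])
  let ?xq = "(?x [^]\<^bsub>sections f ?U\<^esub> (2::nat)) \<otimes>\<^bsub>sections f ?U\<^esub> ?q"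
  have xq: "?xq = frac_section f ?U ((X i)\<^sup>2 * q i) (X j ^ 4)"
  proof -
    have "?x [^]\<^bsub>sections f ?U\<^esub> (2::nat) = frac_section f ?U ((X i)\<^sup>2) ((X j)\<^sup>2)"
      by (rule frac_section_square[OF U fx])
    moreover have "frac_section f ?U ((X i)\<^sup>2) ((X j)\<^sup>2) \<otimes>\<^bsub>sections f ?U\<^esub> ?q =
        frac_section f ?U ((X i)\<^sup>2 * q i) ((X j)\<^sup>2 * (X j)\<^sup>2)"
      by (rule frac_section_mult[OF U fx2 fq])
    ultimately show ?thesis by (simp flip: power_add)
  qed
  have fxq: "((X i)\<^sup>2 * q i, X j ^ 4) \<in> fractions P" if "P \<in> ?U" for P
    by (rule fractions_X_power[OF that hx])
  have xqs: "?xq \<in> carrier (sections f ?U)" unfolding xq by (rule frac_section_chart[OF hx])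
  have "frac_section f ?U ((X i)\<^sup>2 * q i + ?S) (X j ^ 4) = ?xq \<oplus>\<^bsub>sections f ?U\<^esub> ?s"
  proof -
    have "?xq \<oplus>\<^bsub>sections f ?U\<^esub> ?s =
        frac_section f ?U ((X i)\<^sup>2 * q i * X j ^ 4 + ?S * X j ^ 4) (X j ^ 4 * X j ^ 4)"
      unfolding xq by (rule frac_section_add[OF U fxq fS])
    also have "\<dots> = frac_section f ?U ((X i)\<^sup>2 * q i + ?S) (X j ^ 4)"
      by (rule frac_section_cong[OF U fractions_add[OF open_subset_prime[OF U] fxq fS]
            fractions_X_power[OF _ homogeneous_add[OF hx hS]] f(1)]) (simp_all add: algebra_simps)
    finally show ?thesis by simp
  qed
  then have "\<phi> ?U (frac_section f ?U ((X i)\<^sup>2 * q i + ?S) (X j ^ 4)) =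
      (?x \<otimes>\<^bsub>sections f ?U\<^esub> \<phi> ?U ?q) \<oplus>\<^bsub>sections f ?U\<^esub> \<phi> ?U ?s"
    by (simp add: phi_add[OF U xqs s] phi_square_mult[OF U x qs])
  then have "\<phi> ?U (frac_section f ?U ((X i)\<^sup>2 * q i + ?S) (X j ^ 4)) Q =
      stalk_add f Q (stalk_mult f Q (frac f Q (X i) (X j)) (frac f Q (theta (q i)) (X j)))
        (frac f Q ?T ((X j)\<^sup>2))"
    using Q insert.IH chart_value_theta[OF q Q, of i]
    by (simp add: section_add_apply section_mult_apply frac_section_apply chart_value_def)
  also have "\<dots> = frac f Q (X i * theta (q i) * (X j)\<^sup>2 + ?T * (X j * X j)) (X j * X j * (X j)\<^sup>2)"
    unfolding stalk_mult_frac[OF pQ fx[OF Q] ft]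
    by (rule stalk_add_frac[OF pQ fractions_mult[OF pQ fx[OF Q] ft] fT])
  also have "\<dots> = frac f Q (X i * theta (q i) + ?T) ((X j)\<^sup>2)"
    by (rule frac_cross_eq[OF pQ fractions_add[OF pQ fractions_mult[OF pQ fx[OF Q] ft] fT]
          fractions_X_power[OF Q homogeneous_add[OF hxt hT]]])
      (simp add: power2_eq_square algebra_simps)
  finally show ?case using insert.hyps by simp
qed

text \<open>The shadow of \<open>\<theta>\<close> mapping multiples of \<open>f\<close> to multiples of \<open>f\<close>: here the result is a quadratic
  form, so being a multiple of \<open>f\<close> means being zero.\<close>
lemma theta_relation:
  assumes q: "\<And>i. homogeneous 2 (q i)" and dvd: "f dvd (\<Sum>i\<in>UNIV. (X i)\<^sup>2 * q i)"
  shows "(\<Sum>i\<in>UNIV. X i * theta (q i)) = 0"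
proof (rule small_form_eq_0[of 2])
  show "homogeneous 2 (\<Sum>i\<in>UNIV. X i * theta (q i))"
    using homogeneous_mult[OF homogeneous_X theta_linear[OF q]]
    by (intro homogeneous_sum) (simp add: numeral_2_eq_2)
  show "2 < df" by (rule f(3))
  fix Q j assume Q: "Q \<in> chart j"
  have h: "homogeneous 4 (\<Sum>i\<in>UNIV. (X i)\<^sup>2 * q i)"
    using homogeneous_mult[OF homogeneous_X_power[of 2] q] by (intro homogeneous_sum) simp
  have "frac_section f (chart j) (\<Sum>i\<in>UNIV. (X i)\<^sup>2 * q i) (X j ^ 4) =
      frac_section f (chart j) 0 (X j ^ 4)"
    using dvd by (intro frac_section_cong[OF open_basic_open_X fractions_X_power[OF _ h]
          fractions_X_power[OF _ homogeneous_zero] f(1)]) auto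
  then show "frac f Q (\<Sum>i\<in>UNIV. X i * theta (q i)) (X j ^ 2) = frac f Q 0 (X j ^ 2)"
    using phi_sum_squares[of q, OF q Q, of UNIV] phi_zero[OF Q, of 4 2] by simp
qed

end

section \<open>Forms in the ideal of squares of the variables\<close>

lemma lookup_X_mult_quadratic:
  fixes l :: "('n::finite, 'k::field) mpoly"
  shows "coeff_at (X m * l) (Poly_Mapping.single i 1 + Poly_Mapping.single c 1) =
    (if m = i then coeff_at l (Poly_Mapping.single c 1)
     else if m = c then coeff_at l (Poly_Mapping.single i 1) else 0)"
proof -
  have other: "coeff_at (X m * l) (Poly_Mapping.single i 1 + Poly_Mapping.single c 1) = 0"
    if "m \<noteq> i" "m \<noteq> c"
    unfolding X_def
  proof (rule lookup_single_mult_eq_0)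
    fix n show "Poly_Mapping.single i 1 + Poly_Mapping.single c 1 \<noteq> Poly_Mapping.single m (1::nat) + n"
    proof
      assume "Poly_Mapping.single i 1 + Poly_Mapping.single c 1 = Poly_Mapping.single m (1::nat) + n"
      from arg_cong[OF this, of "\<lambda>p. coeff_at p m"] that show False
        by (simp add: lookup_add lookup_single)
    qed
  qed
  show ?thesis
    using other lookup_single_mult[of "Poly_Mapping.single i 1" 1 l "Poly_Mapping.single c 1"]
      lookup_single_mult[of "Poly_Mapping.single c 1" 1 l "Poly_Mapping.single i 1"]
    by (auto simp: X_def add.commute)
qed

lemma lookup_sum_X_mult:
  fixes l :: "'n::finite \<Rightarrow> ('n, 'k::field) mpoly"
  shows "coeff_at (\<Sum>m\<in>UNIV. X m * l m) (Poly_Mapping.single i 1 + Poly_Mapping.single c 1) =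
    (if i = c then coeff_at (l i) (Poly_Mapping.single i 1)
     else coeff_at (l i) (Poly_Mapping.single c 1) + coeff_at (l c) (Poly_Mapping.single i 1))"
proof -
  have "coeff_at (\<Sum>m\<in>UNIV. X m * l m) (Poly_Mapping.single i 1 + Poly_Mapping.single c 1) =
      (\<Sum>m\<in>UNIV. (if m = i then coeff_at (l i) (Poly_Mapping.single c 1) else 0) +
        (if m = c then if i = c then 0 else coeff_at (l c) (Poly_Mapping.single i 1) else 0))"
    unfolding lookup_sum lookup_X_mult_quadratic by (rule sum.cong) auto
  then show ?thesis by (simp add: sum.distrib)
qed

lemma monom_degree_one:
  assumes "monom_degree (m :: 'n::finite \<Rightarrow>\<^sub>0 nat) = 1"
  shows "\<exists>c. m = Poly_Mapping.single c 1"
proof -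
  have "sum (coeff_at m) UNIV = 1" using assms by (simp add: monom_degree_def)
  then obtain c where c: "coeff_at m c = 1" "\<forall>i\<in>UNIV. c \<noteq> i \<longrightarrow> coeff_at m i = 0"
    using sum_eq_1_iff[of UNIV "coeff_at m"] by auto
  then have "m = Poly_Mapping.single c 1"
    by (intro poly_mapping_eqI) (auto simp: lookup_single when_def)
  then show ?thesis by blast
qed

text \<open>The necessary half of Fedder's criterion for cubics: a cubic form in the ideal of the squares of
  the variables is not split. The relations for \<open>theta\<close> say that the coefficient matrices \<open>M g\<close> are
  alternating, and that the row \<open>i\<close> of \<open>M (L i)\<close> consists of the coefficients of \<open>L i\<close>. As
  \<open>M (L i) c i = M (L c) i i\<close> by the symmetry of the product, all these coefficients vanish.\<close>
theorem not_frobenius_split_sum_squares: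
  fixes L :: "'n::{finite,linorder} \<Rightarrow> ('n, 'k::field) mpoly"
  assumes char: "CHAR('k) = 2" and dist: "i1 \<noteq> i2" "i3 \<noteq> i1" "i3 \<noteq> (i2 :: 'n)"
    and L: "\<And>i. homogeneous 1 (L i)" and sum: "f = (\<Sum>i\<in>UNIV. (X i)\<^sup>2 * L i)" "f \<noteq> 0"
  shows "\<not> frobenius_split f"
proof
  assume "frobenius_split f"
  then obtain \<phi> where \<phi>: "\<forall>U. open_subset f U \<longrightarrow>
        \<phi> U \<in> carrier (sections f U) \<rightarrow> carrier (sections f U) \<and>
        (\<forall>\<sigma> \<in> carrier (sections f U). \<forall>\<tau> \<in> carrier (sections f U).
          \<phi> U (\<sigma> \<oplus>\<^bsub>sections f U\<^esub> \<tau>) = \<phi> U \<sigma> \<oplus>\<^bsub>sections f U\<^esub> \<phi> U \<tau> \<and>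
          \<phi> U ((\<sigma> [^]\<^bsub>sections f U\<^esub> (2::nat)) \<otimes>\<^bsub>sections f U\<^esub> \<tau>)
            = \<sigma> \<otimes>\<^bsub>sections f U\<^esub> \<phi> U \<tau>) \<and>
        (\<forall>\<sigma> \<in> carrier (sections f U).
          \<phi> U (\<sigma> [^]\<^bsub>sections f U\<^esub> (2::nat)) = \<sigma>)"
    "\<forall>U V. open_subset f U \<and> open_subset f V \<and> V \<subseteq> U \<longrightarrow>
        (\<forall>\<sigma> \<in> carrier (sections f U). \<phi> V (restrict \<sigma> V) = restrict (\<phi> U \<sigma>) V)"
    unfolding frobenius_split_def char by (elim exE conjE)
  have homf: "homogeneous 3 f"
    by (subst sum(1), intro homogeneous_sum) (use homogeneous_mult[OF homogeneous_X_power[of 2] L] in simp)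
  interpret sheaf_splitting f \<phi> i1 i2 i3 3
  proof unfold_locales
    fix U \<sigma> \<tau> assume "open_subset f U" "\<sigma> \<in> carrier (sections f U)"
    then show "\<phi> U \<sigma> \<in> carrier (sections f U)" "\<phi> U (\<sigma> [^]\<^bsub>sections f U\<^esub> (2::nat)) = \<sigma>"
      using \<phi>(1) by blast+
    assume "\<tau> \<in> carrier (sections f U)"
    with \<open>open_subset f U\<close> \<open>\<sigma> \<in> carrier (sections f U)\<close>
    show "\<phi> U (\<sigma> \<oplus>\<^bsub>sections f U\<^esub> \<tau>) = \<phi> U \<sigma> \<oplus>\<^bsub>sections f U\<^esub> \<phi> U \<tau>"
      "\<phi> U ((\<sigma> [^]\<^bsub>sections f U\<^esub> (2::nat)) \<otimes>\<^bsub>sections f U\<^esub> \<tau>) = \<sigma> \<otimes>\<^bsub>sections f U\<^esub> \<phi> U \<tau>"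
      using \<phi>(1) by blast+
  next
    fix U V \<sigma> assume "open_subset f U" "open_subset f V" "V \<subseteq> U" "\<sigma> \<in> carrier (sections f U)"
    then show "\<phi> V (restrict \<sigma> V) = restrict (\<phi> U \<sigma>) V" using \<phi>(2) by blast
  qed (use dist homf sum in auto)
  have Lg: "homogeneous 2 (L i * g)" if "homogeneous 1 g" for i g
    using homogeneous_mult[OF L that] by (simp add: numeral_2_eq_2)
  have relation: "(\<Sum>i\<in>UNIV. X i * theta (L i * g)) = 0" if g: "homogeneous 1 g" for g
  proof (rule theta_relation[OF Lg[OF g]])
    have "(\<Sum>i\<in>UNIV. (X i)\<^sup>2 * (L i * g)) = f * g"
      by (subst sum(1)) (simp add: sum_distrib_right mult.assoc)
    then show "f dvd (\<Sum>i\<in>UNIV. (X i)\<^sup>2 * (L i * g))" by simp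
  qed
  define M where "M g i c = coeff_at (theta (L i * g)) (Poly_Mapping.single c 1)" for g i c
  have diag: "M g i i = 0" if "homogeneous 1 g" for g i
    using lookup_sum_X_mult[of "\<lambda>i. theta (L i * g)" i i] relation[OF that] by (simp add: M_def)
  have alt: "M g i c + M g c i = 0" if "homogeneous 1 g" "i \<noteq> c" for g i c
    using lookup_sum_X_mult[of "\<lambda>i. theta (L i * g)" i c] relation[OF that(1)] that(2) by (simp add: M_def)
  have self: "M (L i) i c = coeff_at (L i) (Poly_Mapping.single c 1)" for i c
    using theta_square[OF L[of i]] by (simp add: M_def power2_eq_square)
  have "coeff_at (L i) (Poly_Mapping.single c 1) = 0" for i c
  proof (cases "i = c")
    case True
    then show ?thesis using self[of i c] diag[OF L, of i c] by simp
  next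
    case False
    \<comment> \<open>Both are the coefficient of the same variable in \<open>theta (L c * L i)\<close>.\<close>
    have "M (L i) c i = M (L c) i i" by (simp add: M_def mult.commute)
    then show ?thesis using alt[OF L False, of i] self[of i c] diag[OF L, of c i] by simp
  qed
  then have "coeff_at (L i) m = 0" for i m
    using homogeneousD[OF L[of i], of m] monom_degree_one[of m] by (cases "coeff_at (L i) m = 0") auto
  then have "L i = 0" for i by (intro poly_mapping_eqI) simp
  then show False using sum by simp
qed

section \<open>The twenty cubic monomials\<close>

text \<open>The exponent vectors of the cubic monomials, indexed like the twenty coordinates: first
  \<open>x\<^sub>i\<^sup>2 x\<^sub>j\<close>, then the product of the variables other than \<open>x\<^sub>i\<close>.\<close>
definition cubic_monom :: "cubic_index \<Rightarrow> (4 \<Rightarrow>\<^sub>0 nat)"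
  where "cubic_monom r = (case r of
      Inl (i, j) \<Rightarrow> Poly_Mapping.single i 2 + Poly_Mapping.single j 1
    | Inr i \<Rightarrow> \<Sum>j\<in>-{i}. Poly_Mapping.single j 1)"

lemma lookup_cubic_monom_Inl:
  "coeff_at (cubic_monom (Inl (i, j))) k = (if k = i then 2 else 0) + (if k = j then 1 else 0)"
  by (simp add: cubic_monom_def lookup_add lookup_single when_def eq_commute)

lemma lookup_cubic_monom_Inr: "coeff_at (cubic_monom (Inr i)) k = (if k = i then 0 else 1)"
  by (simp add: cubic_monom_def lookup_sum lookup_single when_def)

lemma squarefree_cubic_monom: "squarefree_monom (cubic_monom r) \<longleftrightarrow> r \<in> range Inr"
proof (cases r)
  case (Inl p)
  obtain i j where "p = (i, j)" by (cases p)
  then have "\<not> coeff_at (cubic_monom r) i \<le> 1" using Inl by (simp add: lookup_cubic_monom_Inl)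
  then have "\<not> squarefree_monom (cubic_monom r)" unfolding squarefree_monom_def by blast
  then show ?thesis using Inl by blast
next
  case (Inr i)
  then show ?thesis by (simp add: squarefree_monom_def lookup_cubic_monom_Inr)
qed

lemma monom_degree_cubic_monom: "monom_degree (cubic_monom r) = 3"
proof (cases r)
  case (Inl p)
  obtain i j where "p = (i, j)" by (cases p)
  then show ?thesis using Inl by (simp add: cubic_monom_def)
next
  case (Inr i)
  have "monom_degree (cubic_monom r) = (\<Sum>k\<in>UNIV - {i}. 1)"
    unfolding Inr monom_degree_def lookup_cubic_monom_Inr by (subst sum.remove[of _ i]) auto
  then show ?thesis by (simp add: card_Diff_singleton)
qed

lemma inj_cubic_monom: "inj cubic_monom"
proof (rule injI)
  fix r s assume eq: "cubic_monom r = cubic_monom s"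
  show "r = s"
  proof (cases r; cases s)
    fix p q assume r: "r = Inl p" and s: "s = Inl q"
    obtain i j k l where p: "p = (i, j)" and q: "q = (k, l)" by (cases p, cases q)
    have "coeff_at (cubic_monom (Inl (i, j))) i = coeff_at (cubic_monom (Inl (k, l))) i"
      using eq by (simp add: r s p q)
    then have ik: "i = k" by (simp add: lookup_cubic_monom_Inl split: if_splits)
    have "coeff_at (cubic_monom (Inl (i, j))) j = coeff_at (cubic_monom (Inl (k, l))) j"
      using eq by (simp add: r s p q)
    then have "j = l" by (simp add: lookup_cubic_monom_Inl ik split: if_splits)
    then show ?thesis by (simp add: r s p q ik)
  next
    fix i j assume r: "r = Inr i" and s: "s = Inr j"
    have "coeff_at (cubic_monom (Inr i)) i = coeff_at (cubic_monom (Inr j)) i"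
      using eq by (simp add: r s)
    then show ?thesis by (simp add: r s lookup_cubic_monom_Inr split: if_splits)
  qed (use eq squarefree_cubic_monom[of r] squarefree_cubic_monom[of s] in auto)
qed

text \<open>Among four exponents with sum three, either one is at least two, or three are one and one is
  zero.\<close>
lemma cubic_monom_surj:
  assumes "monom_degree m = 3"
  shows "\<exists>r. m = cubic_monom r"
proof (cases "\<exists>i. coeff_at m i \<ge> 2")
  case True
  then obtain i where i: "coeff_at m i \<ge> 2" by blast
  define n where "n = m - Poly_Mapping.single i 2"
  have m: "m = Poly_Mapping.single i 2 + n"
    using i by (intro poly_mapping_eqI) (auto simp: n_def lookup_add lookup_minus lookup_single when_def)
  then have "monom_degree n = 1" using assms by simp
  then obtain j where "n = Poly_Mapping.single j 1" using monom_degree_one by blast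
  then have "m = cubic_monom (Inl (i, j))" using m by (simp add: cubic_monom_def)
  then show ?thesis by blast
next
  case False
  then have le: "coeff_at m i \<le> 1" for i by (metis Suc_1 not_less_eq_eq)
  define Z where "Z = {i. coeff_at m i = 0}"
  have one: "coeff_at m i = 1" if "i \<notin> Z" for i using le[of i] that by (simp add: Z_def)
  have "3 = (\<Sum>i\<in>UNIV. coeff_at m i)" using assms by (simp add: monom_degree_def)
  also have "\<dots> = (\<Sum>i\<in>-Z. 1)"
  proof (rule sum.mono_neutral_cong_right)
    show "\<forall>i\<in>UNIV - - Z. coeff_at m i = 0" by (simp add: Z_def)
    show "\<And>i. i \<in> - Z \<Longrightarrow> coeff_at m i = 1" using one by blast
  qed simp_all
  finally have "card (-Z) = 3" by simp
  moreover have "card Z + card (-Z) = card (Z \<union> -Z)"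
    by (rule card_Un_disjoint[symmetric]) auto
  ultimately have "card Z = 1" by (simp add: Compl_partition)
  then obtain i where Z: "Z = {i}" by (auto simp: card_1_singleton_iff)
  then have "coeff_at m i = 0" unfolding Z_def by blast
  then have "m = cubic_monom (Inr i)"
    using one Z by (intro poly_mapping_eqI) (simp add: lookup_cubic_monom_Inr)
  then show ?thesis by blast
qed

lemma cubic_form_eq_sum:
  "cubic_form c = (\<Sum>i\<in>UNIV. (X i)\<^sup>2 * (\<Sum>j\<in>UNIV. Const (a_coord c i j) * X j)) +
    (\<Sum>i\<in>UNIV. Poly_Mapping.single (cubic_monom (Inr i)) (b_coord c i))"
proof -
  have compl: "- {1} = {2, 3, 4::4}" "- {2} = {1, 3, 4::4}" "- {3} = {1, 2, 4::4}" "- {4} = {1, 2, 3::4}"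
    unfolding Compl_eq_Diff_UNIV UNIV_4 by auto
  have b: "Const d * X i * X j * X k =
      Poly_Mapping.single (Poly_Mapping.single i 1 + (Poly_Mapping.single j 1 + Poly_Mapping.single k 1)) d"
    for d :: 'a and i j k :: 4
    by (simp add: Const_def X_def mult_single add.assoc)
  show ?thesis
    unfolding cubic_form_def Let_def sum_4[of "\<lambda>i. _ i * _ i"] sum_4[of "\<lambda>i. Poly_Mapping.single _ _"] b
    by (simp add: sum_4 cubic_monom_def compl)
qed

lemma cubic_form_eq_monomials:
  "cubic_form c = (\<Sum>r\<in>UNIV. Poly_Mapping.single (cubic_monom r) (c $ r))"
proof -
  have "(X i)\<^sup>2 * (\<Sum>j\<in>UNIV. Const (a_coord c i j) * X j) =
      (\<Sum>j\<in>UNIV. Poly_Mapping.single (cubic_monom (Inl (i, j))) (a_coord c i j))" for i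
    unfolding sum_distrib_left X_power unfolding Const_def X_def
    by (rule sum.cong) (simp_all add: mult_single cubic_monom_def)
  then have "(\<Sum>i\<in>UNIV. (X i)\<^sup>2 * (\<Sum>j\<in>UNIV. Const (a_coord c i j) * X j)) =
      (\<Sum>p\<in>UNIV. Poly_Mapping.single (cubic_monom (Inl p)) (c $ Inl p))"
    by (simp add: sum.cartesian_product case_prod_unfold)
  moreover have "(\<Sum>r\<in>UNIV. Poly_Mapping.single (cubic_monom r) (c $ r)) =
      (\<Sum>p\<in>UNIV. Poly_Mapping.single (cubic_monom (Inl p)) (c $ Inl p)) +
      (\<Sum>i\<in>UNIV. Poly_Mapping.single (cubic_monom (Inr i)) (b_coord c i))"
    by (subst UNIV_Plus_UNIV[symmetric], subst sum.Plus) simp_all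
  ultimately show ?thesis unfolding cubic_form_eq_sum by simp
qed

lemma lookup_cubic_form: "coeff_at (cubic_form c) (cubic_monom r) = c $ r"
  unfolding cubic_form_eq_monomials
  by (simp add: lookup_sum lookup_single when_def inj_eq[OF inj_cubic_monom])

lemma homogeneous_cubic_form: "homogeneous 3 (cubic_form c)"
  unfolding cubic_form_eq_monomials
  by (intro homogeneous_sum homogeneous_single monom_degree_cubic_monom)

lemma cubic_form_inject: "cubic_form c = cubic_form d \<longleftrightarrow> c = d"
  by (metis lookup_cubic_form vec_eq_iff)

lemma cubic_form_eq_0_iff: "cubic_form c = 0 \<longleftrightarrow> c = 0"
proof -
  have "cubic_form (0 :: 'a ^ cubic_index) = 0" by (simp add: cubic_form_eq_monomials)
  then show ?thesis by (metis cubic_form_inject)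
qed

lemma cubic_form_coordinates:
  assumes "homogeneous 3 f"
  shows "f = cubic_form (\<chi> r. coeff_at f (cubic_monom r))"
proof (rule poly_mapping_eqI)
  fix m
  show "coeff_at f m = coeff_at (cubic_form (\<chi> r. coeff_at f (cubic_monom r))) m"
  proof (cases "monom_degree m = 3")
    case True
    then show ?thesis using cubic_monom_surj[of m] by (auto simp: lookup_cubic_form)
  next
    case False
    then show ?thesis using homogeneousD[OF assms] homogeneousD[OF homogeneous_cubic_form] by metis
  qed
qed

lemma squarefree_coefficient_iff:
  "(\<exists>m. squarefree_monom m \<and> coeff_at (cubic_form c) m \<noteq> 0) \<longleftrightarrow> (\<exists>i. b_coord c i \<noteq> 0)"
proof
  assume "\<exists>m. squarefree_monom m \<and> coeff_at (cubic_form c) m \<noteq> 0"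
  then obtain m where m: "squarefree_monom m" "coeff_at (cubic_form c) m \<noteq> 0" by blast
  obtain r where r: "m = cubic_monom r"
    using cubic_monom_surj homogeneousD[OF homogeneous_cubic_form m(2)] by blast
  then show "\<exists>i. b_coord c i \<noteq> 0"
    using m by (auto simp: squarefree_cubic_monom lookup_cubic_form)
next
  assume "\<exists>i. b_coord c i \<noteq> 0"
  then obtain i where "b_coord c i \<noteq> 0" by blast
  then show "\<exists>m. squarefree_monom m \<and> coeff_at (cubic_form c) m \<noteq> 0"
    by (intro exI[of _ "cubic_monom (Inr i)"]) (simp add: squarefree_cubic_monom lookup_cubic_form)
qed

text \<open>With \<open>h = x\<^sub>i/b\<^sub>i\<close> the coefficient of the product of all variables in \<open>f h\<close> is 1: of the cubic
  monomials only the product of the variables other than \<open>x\<^sub>i\<close> contributes to it.\<close>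
lemma frobenius_split_cubic_form:
  fixes c :: "'k::alg_closed_field ^ cubic_index"
  assumes char: "CHAR('k) = 2" and i: "b_coord c i \<noteq> 0"
  shows "frobenius_split (cubic_form c)"
proof -
  define h :: "(4, 'k) mpoly" where "h = Poly_Mapping.single (Poly_Mapping.single i 1) (1 / b_coord c i)"
  have h: "homogeneous 1 h" unfolding h_def by (rule homogeneous_single) simp
  have hom: "homogeneous CARD(4) (cubic_form c * h)"
    using homogeneous_mult[OF homogeneous_cubic_form h] by simp
  have "odd_exponents (0 :: 4 \<Rightarrow>\<^sub>0 nat) = Poly_Mapping.single i 1 + cubic_monom (Inr i)"
    by (rule poly_mapping_eqI) (simp add: lookup_add lookup_cubic_monom_Inr lookup_single when_def)
  then have "coeff_at (cubic_form c * h) (odd_exponents 0) = 1"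
    using i lookup_single_mult[of "Poly_Mapping.single i 1" "1 / b_coord c i" "cubic_form c" "cubic_monom (Inr i)"]
    by (simp add: h_def mult.commute lookup_cubic_form)
  then have zero: "coeff_at (frobenius_trace (cubic_form c * h)) 0 = 1"
    by (simp add: lookup_frobenius_trace sqrt2_unique[OF char])
  have hom0: "homogeneous 0 (frobenius_trace (cubic_form c * h))"
    using hom by (intro frobenius_trace_homogeneous) simp
  have "coeff_at (frobenius_trace (cubic_form c * h)) m = 0" if "m \<noteq> 0" for m
  proof -
    have "monom_degree m \<noteq> 0"
      using that by (auto simp: monom_degree_def poly_mapping_eq_iff fun_eq_iff)
    then show ?thesis using homogeneousD[OF hom0, of m] by auto
  qed
  then have "frobenius_trace (cubic_form c * h) = 1"
    using zero by (intro poly_mapping_eqI) (auto simp: lookup_one when_def)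
  then show ?thesis by (rule frobenius_split_of_frobenius_trace[OF char hom])
qed

lemma not_frobenius_split_cubic_form:
  fixes c :: "'k::field ^ cubic_index"
  assumes char: "CHAR('k) = 2" and c: "c \<noteq> 0" and b: "\<And>i. b_coord c i = 0"
  shows "\<not> frobenius_split (cubic_form c)"
proof (rule not_frobenius_split_sum_squares[OF char, of 1 2 3])
  show "homogeneous 1 (\<Sum>j\<in>UNIV. Const (a_coord c i j) * X j)" for i
    using homogeneous_mult[OF homogeneous_Const homogeneous_X] by (intro homogeneous_sum) simp
  show "cubic_form c = (\<Sum>i\<in>UNIV. (X i)\<^sup>2 * (\<Sum>j\<in>UNIV. Const (a_coord c i j) * X j))"
    unfolding cubic_form_eq_sum using b by simp
  show "cubic_form c \<noteq> 0" using c by (simp add: cubic_form_eq_0_iff)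
qed simp_all

section \<open>Linear subspaces of the space of cubic surfaces\<close>
lemma proj_point_eqD:
  assumes "proj_point v = proj_point w"
  shows "\<exists>k. k \<noteq> 0 \<and> v = k *s w"
proof -
  have "1 *s v \<in> proj_point v" unfolding proj_point_def by (intro CollectI exI[of _ 1]) simp
  then show ?thesis using assms by (auto simp: proj_point_def)
qed

lemma eval_mpoly_X: "eval_mpoly v (X i) = v $ i"
proof -
  have "(\<Prod>j\<in>UNIV. v $ j ^ coeff_at (Poly_Mapping.single i 1) j) =
      (\<Prod>j\<in>UNIV. if j = i then v $ i else 1)"
    by (rule prod.cong) (auto simp: lookup_single when_def)
  then show ?thesis by (simp add: eval_mpoly_def X_def)
qed

lemma dim_coordinate_subspace:
  fixes A :: "'i::finite set"
  shows "vec.dim {v :: 'k::field ^ 'i. \<forall>i. i \<notin> A \<longrightarrow> v $ i = 0} = card A"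
proof -
  let ?B = "(\<lambda>i. axis i (1::'k)) ` A"
  have "card ?B = vec.dim {v :: 'k ^ 'i. \<forall>i. i \<notin> A \<longrightarrow> v $ i = 0}"
  proof (rule vec.basis_card_eq_dim)
    show "?B \<subseteq> {v. \<forall>i. i \<notin> A \<longrightarrow> v $ i = 0}" by (auto simp: axis_def)
    show "vec.independent ?B"
      by (rule vec.independent_mono[OF independent_cart_basis]) (auto simp: cart_basis_def)
    show "{v. \<forall>i. i \<notin> A \<longrightarrow> v $ i = 0} \<subseteq> vec.span ?B"
    proof
      fix v :: "'k ^ 'i" assume v: "v \<in> {v. \<forall>i. i \<notin> A \<longrightarrow> v $ i = 0}"
      have "(v $ i) *s axis i 1 \<in> vec.span ?B" for i
        using v by (cases "i \<in> A") (auto intro: vec.span_scale vec.span_base vec.span_zero)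
      then have "(\<Sum>i\<in>UNIV. (v $ i) *s axis i 1) \<in> vec.span ?B" by (intro vec.span_sum)
      then show "v \<in> vec.span ?B" by (simp add: basis_expansion)
    qed
  qed
  moreover have "card ?B = card A" by (rule card_image) (auto simp: inj_on_def axis_eq_axis)
  ultimately show ?thesis by simp
qed

lemma no_squarefree_part_eq: "no_squarefree_part = {proj_point c | c. c \<noteq> 0 \<and> (\<forall>i. b_coord c i = 0)}"
  unfolding no_squarefree_part_def forall_4 by simp

lemma proj_linear_no_squarefree_part:
  "proj_linear_subspace 4 (no_squarefree_part :: ('k::field ^ cubic_index) set set)"
proof -
  let ?W = "{v :: 'k ^ cubic_index. \<forall>r. r \<notin> range Inl \<longrightarrow> v $ r = 0}"
  have W: "v \<in> ?W \<longleftrightarrow> (\<forall>i. b_coord v i = 0)" for v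
  proof
    assume "\<forall>i. b_coord v i = 0"
    then have "v $ r = 0" if "r \<notin> range Inl" for r using that by (cases r) auto
    then show "v \<in> ?W" by blast
  qed auto
  have "vec.dim ?W + 4 = CARD(cubic_index)"
    unfolding dim_coordinate_subspace by (simp add: card_image)
  moreover have "vec.subspace ?W" by (auto intro!: vec.subspaceI)
  moreover have "no_squarefree_part = {proj_point v | v. v \<noteq> 0 \<and> v \<in> ?W}"
    unfolding W no_squarefree_part_eq ..
  ultimately show ?thesis unfolding proj_linear_subspace_def by blast
qed

lemma proj_zariski_closed_no_squarefree_part:
  "proj_zariski_closed (no_squarefree_part :: ('k::field ^ cubic_index) set set)"
  unfolding proj_zariski_closed_def no_squarefree_part_eq
proof (intro exI[of _ "range (\<lambda>i. X (Inr i))"] conjI)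
  show "\<forall>g\<in>range (\<lambda>i. X (Inr i)). \<exists>d. homogeneous d g" using homogeneous_X by blast
qed (simp add: eval_mpoly_X)

section \<open>The Frobenius split cubic surfaces\<close>

theorem proposition3p1:
  assumes "CHAR('k::alg_closed_field) = 2"
  shows
    "(\<forall>f :: (4, 'k) mpoly. homogeneous 3 f \<longrightarrow> (\<exists>!c. f = cubic_form c)) \<and>
     (\<forall>c :: 'k ^ cubic_index. homogeneous 3 (cubic_form c)) \<and>
     (frobenius_split_cubics :: ('k ^ cubic_index) set set) \<noteq> {} \<and>
     proj_zariski_open (frobenius_split_cubics :: ('k ^ cubic_index) set set) \<and>
     (frobenius_split_cubics :: ('k ^ cubic_index) set set) = proj_space - no_squarefree_part \<and>
     proj_linear_subspace 4 (no_squarefree_part :: ('k ^ cubic_index) set set) \<and>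
     (\<forall>c :: 'k ^ cubic_index. c \<noteq> 0 \<longrightarrow>
        (frobenius_split (cubic_form c) \<longleftrightarrow> (\<exists>i. b_coord c i \<noteq> 0))) \<and>
     (\<forall>f :: (4, 'k) mpoly. homogeneous 3 f \<and> f \<noteq> 0 \<longrightarrow>
        (frobenius_split f \<longleftrightarrow>
          (\<exists>m. squarefree_monom m \<and> Poly_Mapping.lookup f m \<noteq> 0)))"
proof -
  have split_iff: "frobenius_split (cubic_form c) \<longleftrightarrow> (\<exists>i. b_coord c i \<noteq> 0)"
    if "c \<noteq> 0" for c :: "'k ^ cubic_index"
    using frobenius_split_cubic_form[OF assms] not_frobenius_split_cubic_form[OF assms that] by blast
  have unique: "\<exists>!c. f = cubic_form c" if "homogeneous 3 f" for f :: "(4, 'k) mpoly"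
    using cubic_form_coordinates[OF that] cubic_form_inject by metis
  have complement: "(frobenius_split_cubics :: ('k ^ cubic_index) set set) = proj_space - no_squarefree_part"
  proof (intro equalityI subsetI)
    fix p :: "('k ^ cubic_index) set" assume "p \<in> frobenius_split_cubics"
    then obtain c where c: "p = proj_point c" "c \<noteq> 0" "frobenius_split (cubic_form c)"
      by (auto simp: frobenius_split_cubics_def)
    then obtain i where i: "b_coord c i \<noteq> 0" using split_iff by blast
    have "p \<notin> no_squarefree_part"
    proof
      assume "p \<in> no_squarefree_part"
      then obtain d where d: "p = proj_point d" "\<forall>i. b_coord d i = 0"
        by (auto simp: no_squarefree_part_eq)
      then obtain k where "c = k *s d" using proj_point_eqD c(1) by metis
      with d i show False by simp
    qed
    then show "p \<in> proj_space - no_squarefree_part" using c by (auto simp: proj_space_def)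
  next
    fix p :: "('k ^ cubic_index) set" assume p: "p \<in> proj_space - no_squarefree_part"
    then obtain c where c: "p = proj_point c" "c \<noteq> 0" by (auto simp: proj_space_def)
    then have "\<exists>i. b_coord c i \<noteq> 0" using p by (auto simp: no_squarefree_part_eq)
    then show "p \<in> frobenius_split_cubics"
      using c split_iff by (auto simp: frobenius_split_cubics_def)
  qed
  have subset: "no_squarefree_part \<subseteq> (proj_space :: ('k ^ cubic_index) set set)"
    by (auto simp: no_squarefree_part_eq proj_space_def)
  have "proj_zariski_open (frobenius_split_cubics :: ('k ^ cubic_index) set set)"
    using proj_zariski_closed_no_squarefree_part subset
    unfolding proj_zariski_open_def complement by (simp add: double_diff)
  moreover have "(frobenius_split_cubics :: ('k ^ cubic_index) set set) \<noteq> {}"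
  proof -
    let ?c = "axis (Inr 1) 1 :: 'k ^ cubic_index"
    have "b_coord ?c 1 \<noteq> 0" by (simp add: axis_def)
    moreover from this have "?c \<noteq> 0" by (metis zero_index)
    ultimately have "proj_point ?c \<in> frobenius_split_cubics"
      using split_iff unfolding frobenius_split_cubics_def by blast
    then show ?thesis by blast
  qed
  moreover have "frobenius_split f \<longleftrightarrow> (\<exists>m. squarefree_monom m \<and> coeff_at f m \<noteq> 0)"
    if f: "homogeneous 3 f" "f \<noteq> 0" for f :: "(4, 'k) mpoly"
  proof -
    obtain c where c: "f = cubic_form c" using unique[OF f(1)] by blast
    then have "c \<noteq> 0" using f(2) by (simp add: cubic_form_eq_0_iff)
    then show ?thesis unfolding c squarefree_coefficient_iff by (rule split_iff)
  qed
  ultimately show ?thesis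
    using unique homogeneous_cubic_form complement proj_linear_no_squarefree_part split_iff by blast
qed

end
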